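(* Let $A\to B\to C$ be an $F$-split extension of $H$-algebras. There exists a commutative diagram of extensions $$\begin{array}{ccccc}A&\to&B&\to&C\\ {\scriptstyle\xi}\uparrow&&\uparrow&&\uparrow{\scriptstyle 1_C}\\ J(C)&\xrightarrow{\iota_C}&T(C)&\xrightarrow{\eta_C}&C.\end{array}$$ Furthermore, $\xi$ is unique up to elementary homotopy.
   Context: $H$ is a fixed unital, not necessarily commutative ring. An $H$-algebra is a monoid, possibly without unit, in $H$-bimodules with $\otimes_H$; $\mathrm{Alg}_H$ is the category of all $H$-algebras or, if $H$ is commutative, that of central ones (a fixed choice). $\mathfrak U$ is a fixed underlying category: sets, abelian groups, or $H$-bimodules (central ones in the central case); $F:\mathrm{Alg}_H\to\mathfrak U$ is the forgetful functor, $\tilde T$ its left adjoint, $T=\tilde T\circ F$, $\eta_C:T(C)\to C$ is the counit (which is surjective), $J(C)=\ker\eta_C$ and $\iota_C:J(C)\to T(C)$ the inclusion. An extension is a sequence $A\xrightarrow{f}B\xrightarrow{g}C$ of homomorphisms in which $f$ is a kernel of $g$ and $g$ a cokernel of $f$; it is $F$-split if $F(g)$ has a section in $\mathfrak U$. Homomorphisms $f_0,f_1:A\to B$ are elementary homotopic if there is a homomorphism $h:A\to B[t]=B\otimes_{\mathbb Z}\mathbb Z[t]$ with $\mathrm{ev}_ih=f_i$ ($i=0,1$), $\mathrm{ev}_i$ being evaluation of $t$ at $i$. *)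

theory Defs
  imports "HOL-Algebra.UnivPoly"
begin

section \<open>Bimodules and algebras over a not necessarily commutative ring\<close>

text \<open>
  The left action is the field \<open>smult\<close> inherited from \<^theory>\<open>HOL-Algebra.Module\<close>. As there, the
  record also serves for structures that do not use all of its fields: \<open>one\<close> is never
  constrained (algebras need not have a unit), and \<open>mult\<close> is ignored for mere bimodules.
\<close>

record ('h, 'a) bimod = "('h, 'a) module" +
  rsmult :: "['a, 'h] \<Rightarrow> 'a" (infixl \<open>\<odot>\<^sub>r\<index>\<close> 70)

locale bimodule = H?: ring H + M?: abelian_group M
  for H :: "'h ring" (structure) and M :: "('h, 'a) bimod" (structure) +
  assumes l_closed [simp, intro]:
      "\<lbrakk>h \<in> carrier H; x \<in> carrier M\<rbrakk> \<Longrightarrow> h \<odot>\<^bsub>M\<^esub> x \<in> carrier M"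
    and l_add_scal: "\<lbrakk>h \<in> carrier H; k \<in> carrier H; x \<in> carrier M\<rbrakk> \<Longrightarrow>
      (h \<oplus>\<^bsub>H\<^esub> k) \<odot>\<^bsub>M\<^esub> x = h \<odot>\<^bsub>M\<^esub> x \<oplus>\<^bsub>M\<^esub> k \<odot>\<^bsub>M\<^esub> x"
    and l_add: "\<lbrakk>h \<in> carrier H; x \<in> carrier M; y \<in> carrier M\<rbrakk> \<Longrightarrow>
      h \<odot>\<^bsub>M\<^esub> (x \<oplus>\<^bsub>M\<^esub> y) = h \<odot>\<^bsub>M\<^esub> x \<oplus>\<^bsub>M\<^esub> h \<odot>\<^bsub>M\<^esub> y"
    and l_assoc: "\<lbrakk>h \<in> carrier H; k \<in> carrier H; x \<in> carrier M\<rbrakk> \<Longrightarrow>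
      (h \<otimes>\<^bsub>H\<^esub> k) \<odot>\<^bsub>M\<^esub> x = h \<odot>\<^bsub>M\<^esub> (k \<odot>\<^bsub>M\<^esub> x)"
    and l_unit: "x \<in> carrier M \<Longrightarrow> \<one>\<^bsub>H\<^esub> \<odot>\<^bsub>M\<^esub> x = x"
    and r_closed [simp, intro]:
      "\<lbrakk>h \<in> carrier H; x \<in> carrier M\<rbrakk> \<Longrightarrow> x \<odot>\<^sub>r\<^bsub>M\<^esub> h \<in> carrier M"
    and r_add_scal: "\<lbrakk>h \<in> carrier H; k \<in> carrier H; x \<in> carrier M\<rbrakk> \<Longrightarrow>
      x \<odot>\<^sub>r\<^bsub>M\<^esub> (h \<oplus>\<^bsub>H\<^esub> k) = x \<odot>\<^sub>r\<^bsub>M\<^esub> h \<oplus>\<^bsub>M\<^esub> x \<odot>\<^sub>r\<^bsub>M\<^esub> k"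
    and r_add: "\<lbrakk>h \<in> carrier H; x \<in> carrier M; y \<in> carrier M\<rbrakk> \<Longrightarrow>
      (x \<oplus>\<^bsub>M\<^esub> y) \<odot>\<^sub>r\<^bsub>M\<^esub> h = x \<odot>\<^sub>r\<^bsub>M\<^esub> h \<oplus>\<^bsub>M\<^esub> y \<odot>\<^sub>r\<^bsub>M\<^esub> h"
    and r_assoc: "\<lbrakk>h \<in> carrier H; k \<in> carrier H; x \<in> carrier M\<rbrakk> \<Longrightarrow>
      x \<odot>\<^sub>r\<^bsub>M\<^esub> (h \<otimes>\<^bsub>H\<^esub> k) = (x \<odot>\<^sub>r\<^bsub>M\<^esub> h) \<odot>\<^sub>r\<^bsub>M\<^esub> k"
    and r_unit: "x \<in> carrier M \<Longrightarrow> x \<odot>\<^sub>r\<^bsub>M\<^esub> \<one>\<^bsub>H\<^esub> = x"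
    and lr_assoc: "\<lbrakk>h \<in> carrier H; k \<in> carrier H; x \<in> carrier M\<rbrakk> \<Longrightarrow>
      (h \<odot>\<^bsub>M\<^esub> x) \<odot>\<^sub>r\<^bsub>M\<^esub> k = h \<odot>\<^bsub>M\<^esub> (x \<odot>\<^sub>r\<^bsub>M\<^esub> k)"

text \<open>
  An associative bimodule homomorphism \<open>A \<otimes>\<^sub>H A \<rightarrow> A\<close>, unfolded through the universal property of
  \<open>\<otimes>\<^sub>H\<close>: a biadditive, \<open>H\<close>-balanced map that is linear for the two outer actions.
\<close>

locale h_algebra = bimodule H A
  for H :: "'h ring" (structure) and A :: "('h, 'a) bimod" (structure) +
  assumes mult_closed [simp, intro]:
      "\<lbrakk>x \<in> carrier A; y \<in> carrier A\<rbrakk> \<Longrightarrow> x \<otimes>\<^bsub>A\<^esub> y \<in> carrier A"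
    and mult_assoc: "\<lbrakk>x \<in> carrier A; y \<in> carrier A; w \<in> carrier A\<rbrakk> \<Longrightarrow>
      (x \<otimes>\<^bsub>A\<^esub> y) \<otimes>\<^bsub>A\<^esub> w = x \<otimes>\<^bsub>A\<^esub> (y \<otimes>\<^bsub>A\<^esub> w)"
    and mult_l_distr: "\<lbrakk>x \<in> carrier A; y \<in> carrier A; w \<in> carrier A\<rbrakk> \<Longrightarrow>
      (x \<oplus>\<^bsub>A\<^esub> y) \<otimes>\<^bsub>A\<^esub> w = x \<otimes>\<^bsub>A\<^esub> w \<oplus>\<^bsub>A\<^esub> y \<otimes>\<^bsub>A\<^esub> w"
    and mult_r_distr: "\<lbrakk>x \<in> carrier A; y \<in> carrier A; w \<in> carrier A\<rbrakk> \<Longrightarrow>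
      w \<otimes>\<^bsub>A\<^esub> (x \<oplus>\<^bsub>A\<^esub> y) = w \<otimes>\<^bsub>A\<^esub> x \<oplus>\<^bsub>A\<^esub> w \<otimes>\<^bsub>A\<^esub> y"
    and mult_l: "\<lbrakk>h \<in> carrier H; x \<in> carrier A; y \<in> carrier A\<rbrakk> \<Longrightarrow>
      (h \<odot>\<^bsub>A\<^esub> x) \<otimes>\<^bsub>A\<^esub> y = h \<odot>\<^bsub>A\<^esub> (x \<otimes>\<^bsub>A\<^esub> y)"
    and mult_r: "\<lbrakk>h \<in> carrier H; x \<in> carrier A; y \<in> carrier A\<rbrakk> \<Longrightarrow>
      x \<otimes>\<^bsub>A\<^esub> (y \<odot>\<^sub>r\<^bsub>A\<^esub> h) = (x \<otimes>\<^bsub>A\<^esub> y) \<odot>\<^sub>r\<^bsub>A\<^esub> h"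
    and mult_balanced: "\<lbrakk>h \<in> carrier H; x \<in> carrier A; y \<in> carrier A\<rbrakk> \<Longrightarrow>
      (x \<odot>\<^sub>r\<^bsub>A\<^esub> h) \<otimes>\<^bsub>A\<^esub> y = x \<otimes>\<^bsub>A\<^esub> (h \<odot>\<^bsub>A\<^esub> y)"

definition central :: "'h ring \<Rightarrow> ('h, 'a) bimod \<Rightarrow> bool" where
  "central H M \<longleftrightarrow> (\<forall>h\<in>carrier H. \<forall>x\<in>carrier M. h \<odot>\<^bsub>M\<^esub> x = x \<odot>\<^sub>r\<^bsub>M\<^esub> h)"

text \<open>
  Objects and morphisms of the category of algebras. The flag \<open>z\<close> selects the central algebras;
  it is only meant to be set when \<open>H\<close> is commutative.
\<close>

definition is_alg :: "bool \<Rightarrow> 'h ring \<Rightarrow> ('h, 'a) bimod \<Rightarrow> bool" where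
  "is_alg z H A \<longleftrightarrow> h_algebra H A \<and> (z \<longrightarrow> central H A)"

definition alg_hom :: "'h ring \<Rightarrow> ('h, 'a) bimod \<Rightarrow> ('h, 'b) bimod \<Rightarrow> ('a \<Rightarrow> 'b) set" where
  "alg_hom H A B = {f \<in> carrier A \<rightarrow> carrier B.
     (\<forall>x\<in>carrier A. \<forall>y\<in>carrier A. f (x \<oplus>\<^bsub>A\<^esub> y) = f x \<oplus>\<^bsub>B\<^esub> f y) \<and>
     (\<forall>x\<in>carrier A. \<forall>y\<in>carrier A. f (x \<otimes>\<^bsub>A\<^esub> y) = f x \<otimes>\<^bsub>B\<^esub> f y) \<and>
     (\<forall>h\<in>carrier H. \<forall>x\<in>carrier A. f (h \<odot>\<^bsub>A\<^esub> x) = h \<odot>\<^bsub>B\<^esub> f x) \<and>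
     (\<forall>h\<in>carrier H. \<forall>x\<in>carrier A. f (x \<odot>\<^sub>r\<^bsub>A\<^esub> h) = f x \<odot>\<^sub>r\<^bsub>B\<^esub> h)}"


section \<open>The underlying category\<close>

datatype underlying = Sets | AbGroups | Bimodules

text \<open>
  Objects of the underlying category are given by the same records, of which only the relevant
  fields are looked at. The forgetful functor is therefore the identity on representatives.
\<close>

definition is_under :: "underlying \<Rightarrow> bool \<Rightarrow> 'h ring \<Rightarrow> ('h, 'a) bimod \<Rightarrow> bool" where
  "is_under u z H X \<longleftrightarrow>
     (u = AbGroups \<longrightarrow> abelian_group X) \<and>
     (u = Bimodules \<longrightarrow> bimodule H X \<and> (z \<longrightarrow> central H X))"

definition under_hom ::
  "underlying \<Rightarrow> 'h ring \<Rightarrow> ('h, 'a) bimod \<Rightarrow> ('h, 'b) bimod \<Rightarrow> ('a \<Rightarrow> 'b) set" where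
  "under_hom u H X Y = {s \<in> carrier X \<rightarrow> carrier Y.
     (u \<noteq> Sets \<longrightarrow> (\<forall>x\<in>carrier X. \<forall>y\<in>carrier X. s (x \<oplus>\<^bsub>X\<^esub> y) = s x \<oplus>\<^bsub>Y\<^esub> s y)) \<and>
     (u = Bimodules \<longrightarrow> (\<forall>h\<in>carrier H. \<forall>x\<in>carrier X.
        s (h \<odot>\<^bsub>X\<^esub> x) = h \<odot>\<^bsub>Y\<^esub> s x \<and> s (x \<odot>\<^sub>r\<^bsub>X\<^esub> h) = s x \<odot>\<^sub>r\<^bsub>Y\<^esub> h))}"


section \<open>Extensions\<close>

definition alg_ideal :: "'h ring \<Rightarrow> ('h, 'a) bimod \<Rightarrow> 'a set \<Rightarrow> bool" where
  "alg_ideal H B I \<longleftrightarrow> additive_subgroup I B \<and>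
     (\<forall>x\<in>I. \<forall>b\<in>carrier B. b \<otimes>\<^bsub>B\<^esub> x \<in> I \<and> x \<otimes>\<^bsub>B\<^esub> b \<in> I) \<and>
     (\<forall>x\<in>I. \<forall>h\<in>carrier H. h \<odot>\<^bsub>B\<^esub> x \<in> I \<and> x \<odot>\<^sub>r\<^bsub>B\<^esub> h \<in> I)"

definition ideal_gen :: "'h ring \<Rightarrow> ('h, 'a) bimod \<Rightarrow> 'a set \<Rightarrow> 'a set" where
  "ideal_gen H B S = \<Inter>{I. alg_ideal H B I \<and> S \<subseteq> I}"

text \<open>
  Up to isomorphism, the kernel of \<open>g\<close> is the subalgebra where \<open>g\<close> vanishes and the cokernel of \<open>f\<close> is
  the quotient by the ideal generated by the image of \<open>f\<close>. The equivalence with the universal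
  properties is proved below (\<open>is_ker_iff_universal\<close>, \<open>is_coker_iff_universal\<close>).
\<close>

definition is_ker ::
  "('h, 'a) bimod \<Rightarrow> ('a \<Rightarrow> 'b) \<Rightarrow> ('h, 'b) bimod \<Rightarrow> ('b \<Rightarrow> 'c) \<Rightarrow> ('h, 'c) bimod \<Rightarrow> bool" where
  "is_ker A f B g C \<longleftrightarrow> bij_betw f (carrier A) (a_kernel B C g)"

definition is_coker :: "'h ring \<Rightarrow>
    ('h, 'a) bimod \<Rightarrow> ('a \<Rightarrow> 'b) \<Rightarrow> ('h, 'b) bimod \<Rightarrow> ('b \<Rightarrow> 'c) \<Rightarrow> ('h, 'c) bimod \<Rightarrow> bool" where
  "is_coker H A f B g C \<longleftrightarrow>
     g ` carrier B = carrier C \<and> a_kernel B C g = ideal_gen H B (f ` carrier A)"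

definition extension :: "bool \<Rightarrow> 'h ring \<Rightarrow>
    ('h, 'a) bimod \<Rightarrow> ('a \<Rightarrow> 'b) \<Rightarrow> ('h, 'b) bimod \<Rightarrow> ('b \<Rightarrow> 'c) \<Rightarrow> ('h, 'c) bimod \<Rightarrow> bool" where
  "extension z H A f B g C \<longleftrightarrow>
     is_alg z H A \<and> is_alg z H B \<and> is_alg z H C \<and>
     f \<in> alg_hom H A B \<and> g \<in> alg_hom H B C \<and>
     is_ker A f B g C \<and> is_coker H A f B g C"

definition F_split ::
  "underlying \<Rightarrow> 'h ring \<Rightarrow> ('h, 'b) bimod \<Rightarrow> ('b \<Rightarrow> 'c) \<Rightarrow> ('h, 'c) bimod \<Rightarrow> bool" where
  "F_split u H B g C \<longleftrightarrow> (\<exists>s \<in> under_hom u H C B. \<forall>x\<in>carrier C. g (s x) = x)"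


text \<open>Morphisms from the sequence \<open>A' \<rightarrow> B' \<rightarrow> C'\<close> to the sequence \<open>A \<rightarrow> B \<rightarrow> C\<close>.\<close>

definition seq_hom :: "'h ring \<Rightarrow>
    ('h, 'd) bimod \<Rightarrow> ('d \<Rightarrow> 'e) \<Rightarrow> ('h, 'e) bimod \<Rightarrow> ('e \<Rightarrow> 'k) \<Rightarrow> ('h, 'k) bimod \<Rightarrow>
    ('h, 'a) bimod \<Rightarrow> ('a \<Rightarrow> 'b) \<Rightarrow> ('h, 'b) bimod \<Rightarrow> ('b \<Rightarrow> 'c) \<Rightarrow> ('h, 'c) bimod \<Rightarrow>
    ('d \<Rightarrow> 'a) \<Rightarrow> ('e \<Rightarrow> 'b) \<Rightarrow> ('k \<Rightarrow> 'c) \<Rightarrow> bool" where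
  "seq_hom H A' f' B' g' C' A f B g C \<alpha> \<beta> \<gamma> \<longleftrightarrow>
     \<alpha> \<in> alg_hom H A' A \<and> \<beta> \<in> alg_hom H B' B \<and> \<gamma> \<in> alg_hom H C' C \<and>
     (\<forall>x\<in>carrier A'. \<beta> (f' x) = f (\<alpha> x)) \<and> (\<forall>x\<in>carrier B'. \<gamma> (g' x) = g (\<beta> x))"


section \<open>The left adjoint of the forgetful functor\<close>

datatype ('h, 'x) alg_term =
    Gen 'x
  | Zero
  | Neg "('h, 'x) alg_term"
  | Add "('h, 'x) alg_term" "('h, 'x) alg_term"
  | Mult "('h, 'x) alg_term" "('h, 'x) alg_term"
  | LScal 'h "('h, 'x) alg_term"
  | RScal "('h, 'x) alg_term" 'h

fun wf_term :: "'h ring \<Rightarrow> ('h, 'x) bimod \<Rightarrow> ('h, 'x) alg_term \<Rightarrow> bool" where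
  "wf_term H X (Gen x) \<longleftrightarrow> x \<in> carrier X"
| "wf_term H X Zero \<longleftrightarrow> True"
| "wf_term H X (Neg s) \<longleftrightarrow> wf_term H X s"
| "wf_term H X (Add s t) \<longleftrightarrow> wf_term H X s \<and> wf_term H X t"
| "wf_term H X (Mult s t) \<longleftrightarrow> wf_term H X s \<and> wf_term H X t"
| "wf_term H X (LScal h s) \<longleftrightarrow> h \<in> carrier H \<and> wf_term H X s"
| "wf_term H X (RScal s h) \<longleftrightarrow> wf_term H X s \<and> h \<in> carrier H"

text \<open>
  The congruence on terms generated by the axioms of algebras (and centrality, if \<open>z\<close> is set),
  together with the relations that make \<open>Gen\<close> a morphism in the underlying category.
\<close>

inductive_set term_cong ::
  "underlying \<Rightarrow> bool \<Rightarrow> 'h ring \<Rightarrow> ('h, 'x) bimod \<Rightarrow> (('h, 'x) alg_term \<times> ('h, 'x) alg_term) set"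
  for u z H X where
  refl: "wf_term H X s \<Longrightarrow> (s, s) \<in> term_cong u z H X"
| sym: "(s, t) \<in> term_cong u z H X \<Longrightarrow> (t, s) \<in> term_cong u z H X"
| trans: "\<lbrakk>(r, s) \<in> term_cong u z H X; (s, t) \<in> term_cong u z H X\<rbrakk> \<Longrightarrow>
    (r, t) \<in> term_cong u z H X"
| Neg: "(s, s') \<in> term_cong u z H X \<Longrightarrow> (Neg s, Neg s') \<in> term_cong u z H X"
| Add: "\<lbrakk>(s, s') \<in> term_cong u z H X; (t, t') \<in> term_cong u z H X\<rbrakk> \<Longrightarrow>
    (Add s t, Add s' t') \<in> term_cong u z H X"
| Mult: "\<lbrakk>(s, s') \<in> term_cong u z H X; (t, t') \<in> term_cong u z H X\<rbrakk> \<Longrightarrow>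
    (Mult s t, Mult s' t') \<in> term_cong u z H X"
| LScal: "\<lbrakk>h \<in> carrier H; (s, s') \<in> term_cong u z H X\<rbrakk> \<Longrightarrow>
    (LScal h s, LScal h s') \<in> term_cong u z H X"
| RScal: "\<lbrakk>h \<in> carrier H; (s, s') \<in> term_cong u z H X\<rbrakk> \<Longrightarrow>
    (RScal s h, RScal s' h) \<in> term_cong u z H X"
| add_assoc: "\<lbrakk>wf_term H X r; wf_term H X s; wf_term H X t\<rbrakk> \<Longrightarrow>
    (Add (Add r s) t, Add r (Add s t)) \<in> term_cong u z H X"
| add_comm: "\<lbrakk>wf_term H X s; wf_term H X t\<rbrakk> \<Longrightarrow> (Add s t, Add t s) \<in> term_cong u z H X"
| add_zero: "wf_term H X s \<Longrightarrow> (Add Zero s, s) \<in> term_cong u z H X"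
| add_neg: "wf_term H X s \<Longrightarrow> (Add (Neg s) s, Zero) \<in> term_cong u z H X"
| l_add_scal: "\<lbrakk>h \<in> carrier H; k \<in> carrier H; wf_term H X s\<rbrakk> \<Longrightarrow>
    (LScal (h \<oplus>\<^bsub>H\<^esub> k) s, Add (LScal h s) (LScal k s)) \<in> term_cong u z H X"
| l_add: "\<lbrakk>h \<in> carrier H; wf_term H X s; wf_term H X t\<rbrakk> \<Longrightarrow>
    (LScal h (Add s t), Add (LScal h s) (LScal h t)) \<in> term_cong u z H X"
| l_assoc: "\<lbrakk>h \<in> carrier H; k \<in> carrier H; wf_term H X s\<rbrakk> \<Longrightarrow>
    (LScal (h \<otimes>\<^bsub>H\<^esub> k) s, LScal h (LScal k s)) \<in> term_cong u z H X"
| l_unit: "wf_term H X s \<Longrightarrow> (LScal \<one>\<^bsub>H\<^esub> s, s) \<in> term_cong u z H X"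
| r_add_scal: "\<lbrakk>h \<in> carrier H; k \<in> carrier H; wf_term H X s\<rbrakk> \<Longrightarrow>
    (RScal s (h \<oplus>\<^bsub>H\<^esub> k), Add (RScal s h) (RScal s k)) \<in> term_cong u z H X"
| r_add: "\<lbrakk>h \<in> carrier H; wf_term H X s; wf_term H X t\<rbrakk> \<Longrightarrow>
    (RScal (Add s t) h, Add (RScal s h) (RScal t h)) \<in> term_cong u z H X"
| r_assoc: "\<lbrakk>h \<in> carrier H; k \<in> carrier H; wf_term H X s\<rbrakk> \<Longrightarrow>
    (RScal s (h \<otimes>\<^bsub>H\<^esub> k), RScal (RScal s h) k) \<in> term_cong u z H X"
| r_unit: "wf_term H X s \<Longrightarrow> (RScal s \<one>\<^bsub>H\<^esub>, s) \<in> term_cong u z H X"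
| lr_assoc: "\<lbrakk>h \<in> carrier H; k \<in> carrier H; wf_term H X s\<rbrakk> \<Longrightarrow>
    (RScal (LScal h s) k, LScal h (RScal s k)) \<in> term_cong u z H X"
| mult_assoc: "\<lbrakk>wf_term H X r; wf_term H X s; wf_term H X t\<rbrakk> \<Longrightarrow>
    (Mult (Mult r s) t, Mult r (Mult s t)) \<in> term_cong u z H X"
| mult_l_distr: "\<lbrakk>wf_term H X r; wf_term H X s; wf_term H X t\<rbrakk> \<Longrightarrow>
    (Mult (Add r s) t, Add (Mult r t) (Mult s t)) \<in> term_cong u z H X"
| mult_r_distr: "\<lbrakk>wf_term H X r; wf_term H X s; wf_term H X t\<rbrakk> \<Longrightarrow>
    (Mult t (Add r s), Add (Mult t r) (Mult t s)) \<in> term_cong u z H X"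
| mult_l: "\<lbrakk>h \<in> carrier H; wf_term H X s; wf_term H X t\<rbrakk> \<Longrightarrow>
    (Mult (LScal h s) t, LScal h (Mult s t)) \<in> term_cong u z H X"
| mult_r: "\<lbrakk>h \<in> carrier H; wf_term H X s; wf_term H X t\<rbrakk> \<Longrightarrow>
    (Mult s (RScal t h), RScal (Mult s t) h) \<in> term_cong u z H X"
| mult_balanced: "\<lbrakk>h \<in> carrier H; wf_term H X s; wf_term H X t\<rbrakk> \<Longrightarrow>
    (Mult (RScal s h) t, Mult s (LScal h t)) \<in> term_cong u z H X"
| central: "\<lbrakk>z; h \<in> carrier H; wf_term H X s\<rbrakk> \<Longrightarrow> (LScal h s, RScal s h) \<in> term_cong u z H X"
| gen_add: "\<lbrakk>u \<noteq> Sets; x \<in> carrier X; y \<in> carrier X; x \<oplus>\<^bsub>X\<^esub> y \<in> carrier X\<rbrakk> \<Longrightarrow>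
    (Gen (x \<oplus>\<^bsub>X\<^esub> y), Add (Gen x) (Gen y)) \<in> term_cong u z H X"
| gen_l: "\<lbrakk>u = Bimodules; h \<in> carrier H; x \<in> carrier X; h \<odot>\<^bsub>X\<^esub> x \<in> carrier X\<rbrakk> \<Longrightarrow>
    (Gen (h \<odot>\<^bsub>X\<^esub> x), LScal h (Gen x)) \<in> term_cong u z H X"
| gen_r: "\<lbrakk>u = Bimodules; h \<in> carrier H; x \<in> carrier X; x \<odot>\<^sub>r\<^bsub>X\<^esub> h \<in> carrier X\<rbrakk> \<Longrightarrow>
    (Gen (x \<odot>\<^sub>r\<^bsub>X\<^esub> h), RScal (Gen x) h) \<in> term_cong u z H X"

definition term_struct :: "'h ring \<Rightarrow> ('h, 'x) bimod \<Rightarrow> ('h, ('h, 'x) alg_term) bimod" where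
  "term_struct H X = \<lparr>carrier = {t. wf_term H X t}, mult = Mult, one = undefined,
     zero = Zero, add = Add, smult = LScal, rsmult = RScal\<rparr>"

definition quot :: "('h, 'a) bimod \<Rightarrow> ('a \<times> 'a) set \<Rightarrow> ('h, 'a set) bimod" where
  "quot S R = \<lparr>carrier = carrier S // R,
     mult = (\<lambda>X Y. \<Union>x\<in>X. \<Union>y\<in>Y. R `` {x \<otimes>\<^bsub>S\<^esub> y}), one = undefined,
     zero = R `` {\<zero>\<^bsub>S\<^esub>}, add = (\<lambda>X Y. \<Union>x\<in>X. \<Union>y\<in>Y. R `` {x \<oplus>\<^bsub>S\<^esub> y}),
     smult = (\<lambda>h X. \<Union>x\<in>X. R `` {h \<odot>\<^bsub>S\<^esub> x}), rsmult = (\<lambda>X h. \<Union>x\<in>X. R `` {x \<odot>\<^sub>r\<^bsub>S\<^esub> h})\<rparr>"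

definition free_alg :: "underlying \<Rightarrow> bool \<Rightarrow> 'h ring \<Rightarrow> ('h, 'x) bimod
    \<Rightarrow> ('h, ('h, 'x) alg_term set) bimod" where
  "free_alg u z H X = quot (term_struct H X) (term_cong u z H X)"

definition free_unit :: "underlying \<Rightarrow> bool \<Rightarrow> 'h ring \<Rightarrow> ('h, 'x) bimod
    \<Rightarrow> 'x \<Rightarrow> ('h, 'x) alg_term set" where
  "free_unit u z H X x = term_cong u z H X `` {Gen x}"

primrec eval_term :: "('h, 'b) bimod \<Rightarrow> ('x \<Rightarrow> 'b) \<Rightarrow> ('h, 'x) alg_term \<Rightarrow> 'b" where
  "eval_term B s (Gen x) = s x"
| "eval_term B s Zero = \<zero>\<^bsub>B\<^esub>"
| "eval_term B s (Neg a) = \<ominus>\<^bsub>B\<^esub> eval_term B s a"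
| "eval_term B s (Add a b) = eval_term B s a \<oplus>\<^bsub>B\<^esub> eval_term B s b"
| "eval_term B s (Mult a b) = eval_term B s a \<otimes>\<^bsub>B\<^esub> eval_term B s b"
| "eval_term B s (LScal h a) = h \<odot>\<^bsub>B\<^esub> eval_term B s a"
| "eval_term B s (RScal a h) = eval_term B s a \<odot>\<^sub>r\<^bsub>B\<^esub> h"

definition free_lift :: "('h, 'b) bimod \<Rightarrow> ('x \<Rightarrow> 'b) \<Rightarrow> ('h, 'x) alg_term set \<Rightarrow> 'b" where
  "free_lift B s a = the_elem (eval_term B s ` a)"

text \<open>
  \<open>free_alg\<close> is left adjoint to the forgetful functor, with unit \<open>free_unit\<close> and adjoint transposes
  \<open>free_lift\<close>: see \<open>is_alg_free_alg\<close>, \<open>free_unit_hom\<close> and \<open>free_alg_universal\<close> below. On an algebra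
  \<open>C\<close>, the counit is the transpose of the identity.
\<close>

definition T_alg :: "underlying \<Rightarrow> bool \<Rightarrow> 'h ring \<Rightarrow> ('h, 'c) bimod
    \<Rightarrow> ('h, ('h, 'c) alg_term set) bimod" where
  "T_alg u z H C = free_alg u z H C"

definition counit :: "('h, 'c) bimod \<Rightarrow> ('h, 'c) alg_term set \<Rightarrow> 'c" where
  "counit C = free_lift C (\<lambda>x. x)"

definition J_alg :: "underlying \<Rightarrow> bool \<Rightarrow> 'h ring \<Rightarrow> ('h, 'c) bimod
    \<Rightarrow> ('h, ('h, 'c) alg_term set) bimod" where
  "J_alg u z H C = (T_alg u z H C)\<lparr>carrier := a_kernel (T_alg u z H C) C (counit C)\<rparr>"

definition J_incl :: "('h, 'c) alg_term set \<Rightarrow> ('h, 'c) alg_term set" where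
  "J_incl = (\<lambda>x. x)"


section \<open>Elementary homotopies\<close>

text \<open>
  \<open>B \<otimes>\<^sub>\<int> \<int>[t]\<close> is rendered as the polynomials with coefficients in \<open>B\<close>, where \<open>t\<close> commutes with
  everything: \<open>b \<otimes> t\<^sup>n\<close> is the coefficient family with \<open>b\<close> in degree \<open>n\<close>. Nothing used here of
  \<^const>\<open>UP\<close> refers to a unit of \<open>B\<close>. Evaluation at a natural number \<open>k\<close> sends \<open>b \<otimes> t\<^sup>n\<close>
  to \<open>k\<^sup>n b\<close>.
\<close>

definition poly_alg :: "('h, 'b) bimod \<Rightarrow> ('h, nat \<Rightarrow> 'b) bimod" where
  "poly_alg B = \<lparr>carrier = carrier (UP B), mult = mult (UP B), one = undefined,
     zero = zero (UP B), add = add (UP B),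
     smult = (\<lambda>h p i. h \<odot>\<^bsub>B\<^esub> p i), rsmult = (\<lambda>p h i. p i \<odot>\<^sub>r\<^bsub>B\<^esub> h)\<rparr>"

definition poly_ev :: "('h, 'b) bimod \<Rightarrow> nat \<Rightarrow> (nat \<Rightarrow> 'b) \<Rightarrow> 'b" where
  "poly_ev B k p = (\<Oplus>\<^bsub>B\<^esub>i\<in>{..deg B p}. [(k ^ i)] \<cdot>\<^bsub>B\<^esub> p i)"

definition elem_homotopic ::
  "'h ring \<Rightarrow> ('h, 'a) bimod \<Rightarrow> ('h, 'b) bimod \<Rightarrow> ('a \<Rightarrow> 'b) \<Rightarrow> ('a \<Rightarrow> 'b) \<Rightarrow> bool" where
  "elem_homotopic H A B f0 f1 \<longleftrightarrow> (\<exists>h \<in> alg_hom H A (poly_alg B).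
     \<forall>x\<in>carrier A. poly_ev B 0 (h x) = f0 x \<and> poly_ev B 1 (h x) = f1 x)"

section \<open>Basic facts on algebra homomorphisms\<close>

lemma is_algD: "is_alg z H A \<Longrightarrow> h_algebra H A"
  by (simp add: is_alg_def)

lemma is_alg_group: "is_alg z H A \<Longrightarrow> abelian_group A"
  by (simp add: is_alg_def h_algebra_def bimodule_def)

lemma is_alg_under: "is_alg z H A \<Longrightarrow> is_under u z H A"
  by (simp add: is_alg_def h_algebra_def bimodule_def is_under_def)

lemma alg_hom_under_hom: "f \<in> alg_hom H A B \<Longrightarrow> f \<in> under_hom u H A B"
  by (simp add: alg_hom_def under_hom_def)

lemma alg_hom_closed: "\<lbrakk>f \<in> alg_hom H A B; x \<in> carrier A\<rbrakk> \<Longrightarrow> f x \<in> carrier B"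
  by (auto simp: alg_hom_def)

lemma alg_homD:
  assumes "f \<in> alg_hom H A B"
  shows "\<lbrakk>x \<in> carrier A; y \<in> carrier A\<rbrakk> \<Longrightarrow> f (x \<oplus>\<^bsub>A\<^esub> y) = f x \<oplus>\<^bsub>B\<^esub> f y"
    and "\<lbrakk>x \<in> carrier A; y \<in> carrier A\<rbrakk> \<Longrightarrow> f (x \<otimes>\<^bsub>A\<^esub> y) = f x \<otimes>\<^bsub>B\<^esub> f y"
    and "\<lbrakk>h \<in> carrier H; x \<in> carrier A\<rbrakk> \<Longrightarrow> f (h \<odot>\<^bsub>A\<^esub> x) = h \<odot>\<^bsub>B\<^esub> f x"
    and "\<lbrakk>h \<in> carrier H; x \<in> carrier A\<rbrakk> \<Longrightarrow> f (x \<odot>\<^sub>r\<^bsub>A\<^esub> h) = f x \<odot>\<^sub>r\<^bsub>B\<^esub> h"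
  using assms by (auto simp: alg_hom_def)

lemma alg_homI:
  assumes "\<And>x. x \<in> carrier A \<Longrightarrow> f x \<in> carrier B"
    and "\<And>x y. \<lbrakk>x \<in> carrier A; y \<in> carrier A\<rbrakk> \<Longrightarrow> f (x \<oplus>\<^bsub>A\<^esub> y) = f x \<oplus>\<^bsub>B\<^esub> f y"
    and "\<And>x y. \<lbrakk>x \<in> carrier A; y \<in> carrier A\<rbrakk> \<Longrightarrow> f (x \<otimes>\<^bsub>A\<^esub> y) = f x \<otimes>\<^bsub>B\<^esub> f y"
    and "\<And>h x. \<lbrakk>h \<in> carrier H; x \<in> carrier A\<rbrakk> \<Longrightarrow> f (h \<odot>\<^bsub>A\<^esub> x) = h \<odot>\<^bsub>B\<^esub> f x"
    and "\<And>h x. \<lbrakk>h \<in> carrier H; x \<in> carrier A\<rbrakk> \<Longrightarrow> f (x \<odot>\<^sub>r\<^bsub>A\<^esub> h) = f x \<odot>\<^sub>r\<^bsub>B\<^esub> h"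
  shows "f \<in> alg_hom H A B"
  using assms by (auto simp: alg_hom_def)

lemma alg_hom_id: "(\<lambda>x. x) \<in> alg_hom H A A"
  by (rule alg_homI) auto

lemma alg_hom_comp:
  "\<lbrakk>f \<in> alg_hom H A B; g \<in> alg_hom H B C\<rbrakk> \<Longrightarrow> (\<lambda>x. g (f x)) \<in> alg_hom H A C"
  by (rule alg_homI) (auto simp: alg_homD alg_hom_closed)

lemma alg_hom_zero:
  assumes A: "abelian_group A" and B: "abelian_group B" and f: "f \<in> alg_hom H A B"
  shows "f \<zero>\<^bsub>A\<^esub> = \<zero>\<^bsub>B\<^esub>"
proof -
  interpret A: abelian_group A by fact
  interpret B: abelian_group B by fact
  have "f \<zero>\<^bsub>A\<^esub> \<oplus>\<^bsub>B\<^esub> f \<zero>\<^bsub>A\<^esub> = f \<zero>\<^bsub>A\<^esub>"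
    using alg_homD(1)[OF f, of "\<zero>\<^bsub>A\<^esub>" "\<zero>\<^bsub>A\<^esub>"] by simp
  moreover have "f \<zero>\<^bsub>A\<^esub> \<in> carrier B" using alg_hom_closed[OF f] by simp
  ultimately show ?thesis by (metis B.add.l_cancel_one')
qed

lemma alg_hom_neg:
  assumes A: "abelian_group A" and B: "abelian_group B" and f: "f \<in> alg_hom H A B"
    and x: "x \<in> carrier A"
  shows "f (\<ominus>\<^bsub>A\<^esub> x) = \<ominus>\<^bsub>B\<^esub> f x"
proof -
  interpret A: abelian_group A by fact
  interpret B: abelian_group B by fact
  have "f (\<ominus>\<^bsub>A\<^esub> x) \<oplus>\<^bsub>B\<^esub> f x = \<zero>\<^bsub>B\<^esub>"
    using alg_homD(1)[OF f, of "\<ominus>\<^bsub>A\<^esub> x" x] x alg_hom_zero[OF A B f] by (simp add: A.l_neg)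
  thus ?thesis
    using x alg_hom_closed[OF f] by (metis A.a_inv_closed B.minus_equality)
qed


section \<open>Quotients by congruences\<close>

locale alg_congruence =
  fixes H :: "'h ring" and S :: "('h, 'a) bimod" and R :: "('a \<times> 'a) set"
  assumes ring_H: "ring H" and equiv: "equiv (carrier S) R"
    and zero: "\<zero>\<^bsub>S\<^esub> \<in> carrier S"
    and add_cong: "\<lbrakk>(x, x') \<in> R; (y, y') \<in> R\<rbrakk> \<Longrightarrow> (x \<oplus>\<^bsub>S\<^esub> y, x' \<oplus>\<^bsub>S\<^esub> y') \<in> R"
    and mult_cong: "\<lbrakk>(x, x') \<in> R; (y, y') \<in> R\<rbrakk> \<Longrightarrow> (x \<otimes>\<^bsub>S\<^esub> y, x' \<otimes>\<^bsub>S\<^esub> y') \<in> R"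
    and l_cong: "\<lbrakk>h \<in> carrier H; (x, x') \<in> R\<rbrakk> \<Longrightarrow> (h \<odot>\<^bsub>S\<^esub> x, h \<odot>\<^bsub>S\<^esub> x') \<in> R"
    and r_cong: "\<lbrakk>h \<in> carrier H; (x, x') \<in> R\<rbrakk> \<Longrightarrow> (x \<odot>\<^sub>r\<^bsub>S\<^esub> h, x' \<odot>\<^sub>r\<^bsub>S\<^esub> h) \<in> R"
begin

lemma closed:
  shows "\<lbrakk>x \<in> carrier S; y \<in> carrier S\<rbrakk> \<Longrightarrow> x \<oplus>\<^bsub>S\<^esub> y \<in> carrier S"
    and "\<lbrakk>x \<in> carrier S; y \<in> carrier S\<rbrakk> \<Longrightarrow> x \<otimes>\<^bsub>S\<^esub> y \<in> carrier S"
    and "\<lbrakk>h \<in> carrier H; x \<in> carrier S\<rbrakk> \<Longrightarrow> h \<odot>\<^bsub>S\<^esub> x \<in> carrier S"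
    and "\<lbrakk>h \<in> carrier H; x \<in> carrier S\<rbrakk> \<Longrightarrow> x \<odot>\<^sub>r\<^bsub>S\<^esub> h \<in> carrier S"
  using equiv add_cong[of x x y y] mult_cong[of x x y y] l_cong[of h x x] r_cong[of h x x]
  by (auto simp: equiv_def refl_on_def)

lemma class_closed: "x \<in> carrier S \<Longrightarrow> R `` {x} \<in> carrier (quot S R)"
  by (simp add: quot_def quotientI)

lemma class_eq: "(x, y) \<in> R \<Longrightarrow> R `` {x} = R `` {y}"
  using equiv_class_eq[OF equiv] .

lemma class_eqD: "\<lbrakk>R `` {x} = R `` {y}; y \<in> carrier S\<rbrakk> \<Longrightarrow> (x, y) \<in> R"
  using eq_equiv_class[OF _ equiv] .

lemma quot_ops:
  shows "\<lbrakk>x \<in> carrier S; y \<in> carrier S\<rbrakk> \<Longrightarrow>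
      R `` {x} \<oplus>\<^bsub>quot S R\<^esub> R `` {y} = R `` {x \<oplus>\<^bsub>S\<^esub> y}"
    and "\<lbrakk>x \<in> carrier S; y \<in> carrier S\<rbrakk> \<Longrightarrow>
      R `` {x} \<otimes>\<^bsub>quot S R\<^esub> R `` {y} = R `` {x \<otimes>\<^bsub>S\<^esub> y}"
    and "\<lbrakk>h \<in> carrier H; x \<in> carrier S\<rbrakk> \<Longrightarrow> h \<odot>\<^bsub>quot S R\<^esub> R `` {x} = R `` {h \<odot>\<^bsub>S\<^esub> x}"
    and "\<lbrakk>h \<in> carrier H; x \<in> carrier S\<rbrakk> \<Longrightarrow>
      R `` {x} \<odot>\<^sub>r\<^bsub>quot S R\<^esub> h = R `` {x \<odot>\<^sub>r\<^bsub>S\<^esub> h}"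
    and "\<zero>\<^bsub>quot S R\<^esub> = R `` {\<zero>\<^bsub>S\<^esub>}"
proof -
  assume x: "x \<in> carrier S"
  {
    assume y: "y \<in> carrier S"
    have "congruent2 R R (\<lambda>x y. R `` {x \<oplus>\<^bsub>S\<^esub> y})" "congruent2 R R (\<lambda>x y. R `` {x \<otimes>\<^bsub>S\<^esub> y})"
      by (auto intro!: congruent2I' class_eq add_cong mult_cong)
    thus "R `` {x} \<oplus>\<^bsub>quot S R\<^esub> R `` {y} = R `` {x \<oplus>\<^bsub>S\<^esub> y}"
      "R `` {x} \<otimes>\<^bsub>quot S R\<^esub> R `` {y} = R `` {x \<otimes>\<^bsub>S\<^esub> y}"
      using UN_equiv_class2[OF equiv equiv _ x y] by (simp_all add: quot_def)
  next
    assume h: "h \<in> carrier H"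
    have "(\<lambda>x. R `` {h \<odot>\<^bsub>S\<^esub> x}) respects R" "(\<lambda>x. R `` {x \<odot>\<^sub>r\<^bsub>S\<^esub> h}) respects R"
      using h by (auto intro!: congruentI class_eq l_cong r_cong)
    thus "h \<odot>\<^bsub>quot S R\<^esub> R `` {x} = R `` {h \<odot>\<^bsub>S\<^esub> x}"
      "R `` {x} \<odot>\<^sub>r\<^bsub>quot S R\<^esub> h = R `` {x \<odot>\<^sub>r\<^bsub>S\<^esub> h}"
      using UN_equiv_class[OF equiv _ x] by (simp_all add: quot_def)
  }
qed (simp add: quot_def)

lemma quot_cases:
  assumes "X \<in> carrier (quot S R)"
  obtains x where "x \<in> carrier S" "X = R `` {x}"
  using assms by (auto simp: quot_def elim: quotientE)

lemma is_alg_quot: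
  assumes "\<And>x y w. \<lbrakk>x \<in> carrier S; y \<in> carrier S; w \<in> carrier S\<rbrakk> \<Longrightarrow>
      ((x \<oplus>\<^bsub>S\<^esub> y) \<oplus>\<^bsub>S\<^esub> w, x \<oplus>\<^bsub>S\<^esub> (y \<oplus>\<^bsub>S\<^esub> w)) \<in> R"
    and "\<And>x y. \<lbrakk>x \<in> carrier S; y \<in> carrier S\<rbrakk> \<Longrightarrow> (x \<oplus>\<^bsub>S\<^esub> y, y \<oplus>\<^bsub>S\<^esub> x) \<in> R"
    and "\<And>x. x \<in> carrier S \<Longrightarrow> (\<zero>\<^bsub>S\<^esub> \<oplus>\<^bsub>S\<^esub> x, x) \<in> R"
    and neg: "\<And>x. x \<in> carrier S \<Longrightarrow> \<exists>y\<in>carrier S. (y \<oplus>\<^bsub>S\<^esub> x, \<zero>\<^bsub>S\<^esub>) \<in> R"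
    and "\<And>h k x. \<lbrakk>h \<in> carrier H; k \<in> carrier H; x \<in> carrier S\<rbrakk> \<Longrightarrow>
      ((h \<oplus>\<^bsub>H\<^esub> k) \<odot>\<^bsub>S\<^esub> x, h \<odot>\<^bsub>S\<^esub> x \<oplus>\<^bsub>S\<^esub> k \<odot>\<^bsub>S\<^esub> x) \<in> R"
    and "\<And>h x y. \<lbrakk>h \<in> carrier H; x \<in> carrier S; y \<in> carrier S\<rbrakk> \<Longrightarrow>
      (h \<odot>\<^bsub>S\<^esub> (x \<oplus>\<^bsub>S\<^esub> y), h \<odot>\<^bsub>S\<^esub> x \<oplus>\<^bsub>S\<^esub> h \<odot>\<^bsub>S\<^esub> y) \<in> R"
    and "\<And>h k x. \<lbrakk>h \<in> carrier H; k \<in> carrier H; x \<in> carrier S\<rbrakk> \<Longrightarrow>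
      ((h \<otimes>\<^bsub>H\<^esub> k) \<odot>\<^bsub>S\<^esub> x, h \<odot>\<^bsub>S\<^esub> (k \<odot>\<^bsub>S\<^esub> x)) \<in> R"
    and "\<And>x. x \<in> carrier S \<Longrightarrow> (\<one>\<^bsub>H\<^esub> \<odot>\<^bsub>S\<^esub> x, x) \<in> R"
    and "\<And>h k x. \<lbrakk>h \<in> carrier H; k \<in> carrier H; x \<in> carrier S\<rbrakk> \<Longrightarrow>
      (x \<odot>\<^sub>r\<^bsub>S\<^esub> (h \<oplus>\<^bsub>H\<^esub> k), x \<odot>\<^sub>r\<^bsub>S\<^esub> h \<oplus>\<^bsub>S\<^esub> x \<odot>\<^sub>r\<^bsub>S\<^esub> k) \<in> R"
    and "\<And>h x y. \<lbrakk>h \<in> carrier H; x \<in> carrier S; y \<in> carrier S\<rbrakk> \<Longrightarrow>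
      ((x \<oplus>\<^bsub>S\<^esub> y) \<odot>\<^sub>r\<^bsub>S\<^esub> h, x \<odot>\<^sub>r\<^bsub>S\<^esub> h \<oplus>\<^bsub>S\<^esub> y \<odot>\<^sub>r\<^bsub>S\<^esub> h) \<in> R"
    and "\<And>h k x. \<lbrakk>h \<in> carrier H; k \<in> carrier H; x \<in> carrier S\<rbrakk> \<Longrightarrow>
      (x \<odot>\<^sub>r\<^bsub>S\<^esub> (h \<otimes>\<^bsub>H\<^esub> k), (x \<odot>\<^sub>r\<^bsub>S\<^esub> h) \<odot>\<^sub>r\<^bsub>S\<^esub> k) \<in> R"
    and "\<And>x. x \<in> carrier S \<Longrightarrow> (x \<odot>\<^sub>r\<^bsub>S\<^esub> \<one>\<^bsub>H\<^esub>, x) \<in> R"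
    and "\<And>h k x. \<lbrakk>h \<in> carrier H; k \<in> carrier H; x \<in> carrier S\<rbrakk> \<Longrightarrow>
      ((h \<odot>\<^bsub>S\<^esub> x) \<odot>\<^sub>r\<^bsub>S\<^esub> k, h \<odot>\<^bsub>S\<^esub> (x \<odot>\<^sub>r\<^bsub>S\<^esub> k)) \<in> R"
    and "\<And>x y w. \<lbrakk>x \<in> carrier S; y \<in> carrier S; w \<in> carrier S\<rbrakk> \<Longrightarrow>
      ((x \<otimes>\<^bsub>S\<^esub> y) \<otimes>\<^bsub>S\<^esub> w, x \<otimes>\<^bsub>S\<^esub> (y \<otimes>\<^bsub>S\<^esub> w)) \<in> R"
    and "\<And>x y w. \<lbrakk>x \<in> carrier S; y \<in> carrier S; w \<in> carrier S\<rbrakk> \<Longrightarrow>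
      ((x \<oplus>\<^bsub>S\<^esub> y) \<otimes>\<^bsub>S\<^esub> w, x \<otimes>\<^bsub>S\<^esub> w \<oplus>\<^bsub>S\<^esub> y \<otimes>\<^bsub>S\<^esub> w) \<in> R"
    and "\<And>x y w. \<lbrakk>x \<in> carrier S; y \<in> carrier S; w \<in> carrier S\<rbrakk> \<Longrightarrow>
      (w \<otimes>\<^bsub>S\<^esub> (x \<oplus>\<^bsub>S\<^esub> y), w \<otimes>\<^bsub>S\<^esub> x \<oplus>\<^bsub>S\<^esub> w \<otimes>\<^bsub>S\<^esub> y) \<in> R"
    and "\<And>h x y. \<lbrakk>h \<in> carrier H; x \<in> carrier S; y \<in> carrier S\<rbrakk> \<Longrightarrow>
      ((h \<odot>\<^bsub>S\<^esub> x) \<otimes>\<^bsub>S\<^esub> y, h \<odot>\<^bsub>S\<^esub> (x \<otimes>\<^bsub>S\<^esub> y)) \<in> R"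
    and "\<And>h x y. \<lbrakk>h \<in> carrier H; x \<in> carrier S; y \<in> carrier S\<rbrakk> \<Longrightarrow>
      (x \<otimes>\<^bsub>S\<^esub> (y \<odot>\<^sub>r\<^bsub>S\<^esub> h), (x \<otimes>\<^bsub>S\<^esub> y) \<odot>\<^sub>r\<^bsub>S\<^esub> h) \<in> R"
    and "\<And>h x y. \<lbrakk>h \<in> carrier H; x \<in> carrier S; y \<in> carrier S\<rbrakk> \<Longrightarrow>
      ((x \<odot>\<^sub>r\<^bsub>S\<^esub> h) \<otimes>\<^bsub>S\<^esub> y, x \<otimes>\<^bsub>S\<^esub> (h \<odot>\<^bsub>S\<^esub> y)) \<in> R"
    and "\<And>h x. \<lbrakk>z; h \<in> carrier H; x \<in> carrier S\<rbrakk> \<Longrightarrow> (h \<odot>\<^bsub>S\<^esub> x, x \<odot>\<^sub>r\<^bsub>S\<^esub> h) \<in> R"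
  shows "is_alg z H (quot S R)"
proof -
  interpret H: ring H by (rule ring_H)
  note * = assms(1-3,5-)[THEN class_eq]
  have grp: "abelian_group (quot S R)"
  proof (rule abelian_groupI)
    fix X assume "X \<in> carrier (quot S R)"
    then obtain x where x: "x \<in> carrier S" "X = R `` {x}" by (rule quot_cases)
    from neg[OF x(1)] obtain y where y: "y \<in> carrier S" "(y \<oplus>\<^bsub>S\<^esub> x, \<zero>\<^bsub>S\<^esub>) \<in> R" by blast
    show "\<exists>Y\<in>carrier (quot S R). Y \<oplus>\<^bsub>quot S R\<^esub> X = \<zero>\<^bsub>quot S R\<^esub>"
      using x y class_eq[OF y(2)] by (intro bexI[of _ "R `` {y}"]) (auto simp: quot_ops class_closed)
  next
    fix X Y assume "X \<in> carrier (quot S R)" "Y \<in> carrier (quot S R)"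
    thus "X \<oplus>\<^bsub>quot S R\<^esub> Y = Y \<oplus>\<^bsub>quot S R\<^esub> X"
      by (elim quot_cases) (simp add: quot_ops *(2))
  qed (auto elim!: quot_cases simp: quot_ops closed class_closed zero *(1,3))
  have "h_algebra H (quot S R)"
    by (intro h_algebra.intro bimodule.intro bimodule_axioms.intro h_algebra_axioms.intro
        ring_H grp; elim quot_cases; simp add: quot_ops closed class_closed *(4-18))
  moreover have "z \<longrightarrow> central H (quot S R)"
    unfolding central_def by (auto elim!: quot_cases simp: quot_ops *(19))
  ultimately show ?thesis by (simp add: is_alg_def)
qed

lemma class_hom: "(\<lambda>x. R `` {x}) \<in> alg_hom H S (quot S R)"
  by (rule alg_homI) (auto simp: class_closed quot_ops)

end


section \<open>The adjunction\<close>

lemma term_cong_wf: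
  assumes "ring H" and "(s, t) \<in> term_cong u z H X"
  shows "wf_term H X s \<and> wf_term H X t"
proof -
  interpret ring H by fact
  from assms(2) show ?thesis by induction auto
qed

lemma term_congruence:
  assumes H: "ring H"
  shows "alg_congruence H (term_struct H X) (term_cong u z H X)"
proof (rule alg_congruence.intro)
  show "equiv (carrier (term_struct H X)) (term_cong u z H X)"
  proof (rule equivI)
    show "term_cong u z H X \<subseteq> carrier (term_struct H X) \<times> carrier (term_struct H X)"
      by (auto simp: term_struct_def dest: term_cong_wf[OF H])
    show "refl_on (carrier (term_struct H X)) (term_cong u z H X)"
      by (auto simp: refl_on_def term_struct_def intro: term_cong.refl)
    show "Relation.sym (term_cong u z H X)" by (auto intro!: symI intro: term_cong.sym)
    show "Relation.trans (term_cong u z H X)" by (auto intro!: transI intro: term_cong.trans)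
  qed
qed (use H in \<open>auto simp: term_struct_def intro: term_cong.intros(4-8)\<close>)

theorem is_alg_free_alg:
  assumes H: "ring H"
  shows "is_alg z H (free_alg u z H X)"
proof -
  interpret alg_congruence H "term_struct H X" "term_cong u z H X"
    by (rule term_congruence[OF H])
  have "\<exists>y\<in>carrier (term_struct H X). (y \<oplus>\<^bsub>term_struct H X\<^esub> x, \<zero>\<^bsub>term_struct H X\<^esub>) \<in> term_cong u z H X"
    if "x \<in> carrier (term_struct H X)" for x
    using that term_cong.add_neg[of H X x] by (intro bexI[of _ "Neg x"]) (simp_all add: term_struct_def)
  thus ?thesis
    unfolding free_alg_def
    by (intro is_alg_quot)
      (simp_all add: term_struct_def term_cong.add_assoc term_cong.add_comm term_cong.add_zero
        term_cong.l_add_scal term_cong.l_add term_cong.l_assoc term_cong.l_unit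
        term_cong.r_add_scal term_cong.r_add term_cong.r_assoc term_cong.r_unit
        term_cong.lr_assoc term_cong.mult_assoc term_cong.mult_l_distr term_cong.mult_r_distr
        term_cong.mult_l term_cong.mult_r term_cong.mult_balanced term_cong.central)
qed

theorem free_unit_hom:
  assumes H: "ring H" and X: "is_under u z H X"
  shows "free_unit u z H X \<in> under_hom u H X (free_alg u z H X)"
proof -
  interpret alg_congruence H "term_struct H X" "term_cong u z H X"
    by (rule term_congruence[OF H])
  have gen: "Gen x \<in> carrier (term_struct H X)" if "x \<in> carrier X" for x
    using that by (simp add: term_struct_def)
  have add: "free_unit u z H X (x \<oplus>\<^bsub>X\<^esub> y) =
      free_unit u z H X x \<oplus>\<^bsub>free_alg u z H X\<^esub> free_unit u z H X y"
    if "u \<noteq> Sets" "x \<in> carrier X" "y \<in> carrier X" for x y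
  proof -
    have "abelian_group X" using X that(1) by (cases u) (auto simp: is_under_def bimodule_def)
    then interpret X: abelian_group X .
    show ?thesis
      using class_eq[OF term_cong.gen_add, OF that] that gen quot_ops(1)[of "Gen x" "Gen y"]
      by (simp add: free_unit_def free_alg_def) (simp add: term_struct_def)
  qed
  have scal: "free_unit u z H X (h \<odot>\<^bsub>X\<^esub> x) = h \<odot>\<^bsub>free_alg u z H X\<^esub> free_unit u z H X x \<and>
      free_unit u z H X (x \<odot>\<^sub>r\<^bsub>X\<^esub> h) = free_unit u z H X x \<odot>\<^sub>r\<^bsub>free_alg u z H X\<^esub> h"
    if "u = Bimodules" "h \<in> carrier H" "x \<in> carrier X" for h x
  proof -
    have "bimodule H X" using X that(1) by (auto simp: is_under_def)
    then interpret X: bimodule H X .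
    show ?thesis
      using class_eq[OF term_cong.gen_l, OF that] class_eq[OF term_cong.gen_r, OF that] that gen
        quot_ops(3,4)[of h "Gen x"]
      by (simp add: free_unit_def free_alg_def) (simp add: term_struct_def)
  qed
  show ?thesis
    using add scal gen class_closed by (auto simp: under_hom_def free_unit_def free_alg_def)
qed

lemma eval_term_closed:
  assumes B: "is_alg z H B" and s: "s \<in> carrier X \<rightarrow> carrier B" and t: "wf_term H X t"
  shows "eval_term B s t \<in> carrier B"
proof -
  interpret h_algebra H B by (rule is_algD[OF B])
  show ?thesis using t s by (induction t) auto
qed

lemma eval_term_cong:
  assumes B: "is_alg z H B" and s: "s \<in> under_hom u H X B" and "(a, b) \<in> term_cong u z H X"
  shows "eval_term B s a = eval_term B s b"
proof -
  interpret h_algebra H B by (rule is_algD[OF B])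
  have "s \<in> carrier X \<rightarrow> carrier B" using s by (simp add: under_hom_def)
  note cl = eval_term_closed[OF B this]
  from assms(3) show ?thesis
  proof induction
    case (central h t)
    then show ?case using B cl by (auto simp: is_alg_def Defs.central_def)
  qed (use s in \<open>auto simp: cl M.a_assoc M.l_neg l_add_scal l_add l_assoc l_unit r_add_scal r_add
      r_assoc r_unit lr_assoc mult_assoc mult_l_distr mult_r_distr mult_l mult_r mult_balanced
      under_hom_def intro: M.a_comm\<close>)
qed

lemma free_lift_class:
  assumes H: "ring H" and B: "is_alg z H B" and s: "s \<in> under_hom u H X B" and t: "wf_term H X t"
  shows "free_lift B s (term_cong u z H X `` {t}) = eval_term B s t"
proof -
  have "eval_term B s ` (term_cong u z H X `` {t}) = {eval_term B s t}"
    using eval_term_cong[OF B s] term_cong.refl[OF t] by force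
  thus ?thesis by (simp add: free_lift_def)
qed

theorem free_alg_universal:
  assumes H: "ring H" and B: "is_alg z H B" and s: "s \<in> under_hom u H X B"
  shows "free_lift B s \<in> alg_hom H (free_alg u z H X) B"
    and "x \<in> carrier X \<Longrightarrow> free_lift B s (free_unit u z H X x) = s x"
    and "\<lbrakk>\<phi> \<in> alg_hom H (free_alg u z H X) B;
        \<And>x. x \<in> carrier X \<Longrightarrow> \<phi> (free_unit u z H X x) = s x; a \<in> carrier (free_alg u z H X)\<rbrakk> \<Longrightarrow>
      \<phi> a = free_lift B s a"
proof -
  interpret alg_congruence H "term_struct H X" "term_cong u z H X"
    by (rule term_congruence[OF H])
  interpret B: h_algebra H B by (rule is_algD[OF B])
  have s': "s \<in> carrier X \<rightarrow> carrier B" using s by (simp add: under_hom_def)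
  note cl = eval_term_closed[OF B s']
  have wf: "t \<in> carrier (term_struct H X) \<longleftrightarrow> wf_term H X t" for t by (simp add: term_struct_def)
  have ops: "x \<oplus>\<^bsub>term_struct H X\<^esub> y = Add x y" "x \<otimes>\<^bsub>term_struct H X\<^esub> y = Mult x y"
    "h \<odot>\<^bsub>term_struct H X\<^esub> x = LScal h x" "x \<odot>\<^sub>r\<^bsub>term_struct H X\<^esub> h = RScal x h"
    "\<zero>\<^bsub>term_struct H X\<^esub> = Zero" for x y h by (simp_all add: term_struct_def)
  note lift = free_lift_class[OF H B s]
  note qops = quot_ops[unfolded ops wf, folded free_alg_def]
  show "free_lift B s \<in> alg_hom H (free_alg u z H X) B"
    by (rule alg_homI; unfold free_alg_def; elim quot_cases;
        simp add: quot_ops closed wf lift cl; simp add: ops lift)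
  show "free_lift B s (free_unit u z H X x) = s x" if "x \<in> carrier X"
    using lift[of "Gen x"] that by (simp add: free_unit_def)
  assume \<phi>: "\<phi> \<in> alg_hom H (free_alg u z H X) B"
    and \<phi>_unit: "\<And>x. x \<in> carrier X \<Longrightarrow> \<phi> (free_unit u z H X x) = s x"
    and a: "a \<in> carrier (free_alg u z H X)"
  have grp: "abelian_group (free_alg u z H X)"
    by (rule is_alg_group[OF is_alg_free_alg[OF H]])
  then interpret T: abelian_group "free_alg u z H X" .
  let ?c = "\<lambda>t. term_cong u z H X `` {t}"
  have c: "?c t \<in> carrier (free_alg u z H X)" if "wf_term H X t" for t
    using class_closed[unfolded wf, OF that] by (simp add: free_alg_def)
  have "\<phi> (?c t) = eval_term B s t" if "wf_term H X t" for t
    using that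
  proof (induction t)
    case (Gen x)
    then show ?case using \<phi>_unit by (simp add: free_unit_def)
  next
    case Zero
    then show ?case using alg_hom_zero[OF grp B.M.abelian_group_axioms \<phi>] by (simp add: qops)
  next
    case (Neg t)
    have "?c (Neg t) \<oplus>\<^bsub>free_alg u z H X\<^esub> ?c t = \<zero>\<^bsub>free_alg u z H X\<^esub>"
      using Neg class_eq[OF term_cong.add_neg, of t] by (simp add: qops)
    hence "?c (Neg t) = \<ominus>\<^bsub>free_alg u z H X\<^esub> ?c t"
      using Neg c by (metis T.minus_equality wf_term.simps(3))
    then show ?case using Neg c alg_hom_neg[OF grp B.M.abelian_group_axioms \<phi>] by simp
  next
    case (Add t1 t2)
    then show ?case using alg_homD(1)[OF \<phi> c c, of t1 t2] by (simp add: qops)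
  next
    case (Mult t1 t2)
    then show ?case using alg_homD(2)[OF \<phi> c c, of t1 t2] by (simp add: qops)
  next
    case (LScal h t)
    then show ?case using alg_homD(3)[OF \<phi> _ c, of h t] by (simp add: qops)
  next
    case (RScal t h)
    then show ?case using alg_homD(4)[OF \<phi> _ c, of h t] by (simp add: qops)
  qed
  then show "\<phi> a = free_lift B s a"
    using a lift by (auto simp: free_alg_def wf elim!: quot_cases)
qed

corollary counit_hom:
  assumes "ring H" and "is_alg z H C"
  shows "counit C \<in> alg_hom H (T_alg u z H C) C"
    and "x \<in> carrier C \<Longrightarrow> counit C (free_unit u z H C x) = x"
proof -
  have "(\<lambda>x. x) \<in> under_hom u H C C" by (rule alg_hom_under_hom[OF alg_hom_id])
  from free_alg_universal(1,2)[OF assms this]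
  show "counit C \<in> alg_hom H (T_alg u z H C) C"
    and "x \<in> carrier C \<Longrightarrow> counit C (free_unit u z H C x) = x"
    by (simp_all add: counit_def T_alg_def)
qed


section \<open>The universal properties of kernels and cokernels\<close>

definition ker_test :: "'h ring \<Rightarrow> ('h, 'a) bimod \<Rightarrow> ('a \<Rightarrow> 'b) \<Rightarrow> ('h, 'b) bimod \<Rightarrow> ('b \<Rightarrow> 'c)
    \<Rightarrow> ('h, 'c) bimod \<Rightarrow> ('h, 'd) bimod \<Rightarrow> bool" where
  "ker_test H A f B g C D \<longleftrightarrow>
     (\<forall>d \<in> alg_hom H D B. (\<forall>x\<in>carrier D. g (d x) = \<zero>\<^bsub>C\<^esub>) \<longrightarrow>
        (\<exists>e \<in> alg_hom H D A. (\<forall>x\<in>carrier D. f (e x) = d x) \<and>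
           (\<forall>e' \<in> alg_hom H D A. (\<forall>x\<in>carrier D. f (e' x) = d x) \<longrightarrow> (\<forall>x\<in>carrier D. e' x = e x))))"

definition coker_test :: "'h ring \<Rightarrow> ('h, 'a) bimod \<Rightarrow> ('a \<Rightarrow> 'b) \<Rightarrow> ('h, 'b) bimod \<Rightarrow> ('b \<Rightarrow> 'c)
    \<Rightarrow> ('h, 'c) bimod \<Rightarrow> ('h, 'd) bimod \<Rightarrow> bool" where
  "coker_test H A f B g C D \<longleftrightarrow>
     (\<forall>d \<in> alg_hom H B D. (\<forall>x\<in>carrier A. d (f x) = \<zero>\<^bsub>D\<^esub>) \<longrightarrow>
        (\<exists>e \<in> alg_hom H C D. (\<forall>x\<in>carrier B. e (g x) = d x) \<and>
           (\<forall>e' \<in> alg_hom H C D. (\<forall>x\<in>carrier B. e' (g x) = d x) \<longrightarrow> (\<forall>y\<in>carrier C. e' y = e y))))"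

lemma ker_test_ex:
  assumes "ker_test H A f B g C D" and "d \<in> alg_hom H D B"
    and "\<And>x. x \<in> carrier D \<Longrightarrow> g (d x) = \<zero>\<^bsub>C\<^esub>"
  shows "\<exists>e \<in> alg_hom H D A. \<forall>x\<in>carrier D. f (e x) = d x"
  using assms unfolding ker_test_def by blast

lemma ker_testD:
  assumes "ker_test H A f B g C D" and "d \<in> alg_hom H D B"
    and "\<And>x. x \<in> carrier D \<Longrightarrow> g (d x) = \<zero>\<^bsub>C\<^esub>"
    and "e \<in> alg_hom H D A" and "e' \<in> alg_hom H D A"
    and "\<And>x. x \<in> carrier D \<Longrightarrow> f (e x) = d x" and "\<And>x. x \<in> carrier D \<Longrightarrow> f (e' x) = d x"
    and "x \<in> carrier D"
  shows "e x = e' x"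
proof -
  from assms(1-3) obtain i where
    "\<forall>e \<in> alg_hom H D A. (\<forall>x\<in>carrier D. f (e x) = d x) \<longrightarrow> (\<forall>x\<in>carrier D. e x = i x)"
    unfolding ker_test_def by blast
  note i = bspec[OF this, THEN mp, THEN bspec, OF _ ballI _]
  have "e x = i x" using i[OF assms(4,6,8)] .
  moreover have "e' x = i x" using i[OF assms(5,7,8)] .
  ultimately show ?thesis by simp
qed

lemma coker_test_ex:
  assumes "coker_test H A f B g C D" and "d \<in> alg_hom H B D"
    and "\<And>x. x \<in> carrier A \<Longrightarrow> d (f x) = \<zero>\<^bsub>D\<^esub>"
  shows "\<exists>e \<in> alg_hom H C D. \<forall>x\<in>carrier B. e (g x) = d x"
  using assms unfolding coker_test_def by blast

lemma coker_testD:
  assumes "coker_test H A f B g C D" and "d \<in> alg_hom H B D"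
    and "\<And>x. x \<in> carrier A \<Longrightarrow> d (f x) = \<zero>\<^bsub>D\<^esub>"
    and "e \<in> alg_hom H C D" and "e' \<in> alg_hom H C D"
    and "\<And>x. x \<in> carrier B \<Longrightarrow> e (g x) = d x" and "\<And>x. x \<in> carrier B \<Longrightarrow> e' (g x) = d x"
    and "y \<in> carrier C"
  shows "e y = e' y"
proof -
  from assms(1-3) obtain i where
    "\<forall>e \<in> alg_hom H C D. (\<forall>x\<in>carrier B. e (g x) = d x) \<longrightarrow> (\<forall>y\<in>carrier C. e y = i y)"
    unfolding coker_test_def by blast
  note i = bspec[OF this, THEN mp, THEN bspec, OF _ ballI _]
  have "e y = i y" using i[OF assms(4,6,8)] .
  moreover have "e' y = i y" using i[OF assms(5,7,8)] .
  ultimately show ?thesis by simp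
qed

lemma additive_subgroupI':
  assumes "abelian_group B" and sub: "I \<subseteq> carrier B" and "\<zero>\<^bsub>B\<^esub> \<in> I"
    and "\<And>x y. \<lbrakk>x \<in> I; y \<in> I\<rbrakk> \<Longrightarrow> x \<oplus>\<^bsub>B\<^esub> y \<in> I" and neg: "\<And>x. x \<in> I \<Longrightarrow> \<ominus>\<^bsub>B\<^esub> x \<in> I"
  shows "additive_subgroup I B"
proof -
  interpret B: abelian_group B by fact
  show ?thesis
    by (rule additive_subgroupI, rule B.add.subgroupI)
      (use assms(3,4) sub neg in \<open>auto simp: a_inv_def\<close>)
qed

lemma alg_ideal_ker:
  assumes B: "is_alg z H B" and C: "is_alg z H C" and g: "g \<in> alg_hom H B C"
  shows "alg_ideal H B (a_kernel B C g)"
proof -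
  interpret B: h_algebra H B by (rule is_algD[OF B])
  interpret C: h_algebra H C by (rule is_algD[OF C])
  note zero = alg_hom_zero[OF B.M.abelian_group_axioms C.M.abelian_group_axioms g]
  note neg = alg_hom_neg[OF B.M.abelian_group_axioms C.M.abelian_group_axioms g]
  have mult0: "y \<otimes>\<^bsub>C\<^esub> \<zero>\<^bsub>C\<^esub> = \<zero>\<^bsub>C\<^esub>" "\<zero>\<^bsub>C\<^esub> \<otimes>\<^bsub>C\<^esub> y = \<zero>\<^bsub>C\<^esub>" if "y \<in> carrier C" for y
    using C.mult_r_distr[of "\<zero>\<^bsub>C\<^esub>" "\<zero>\<^bsub>C\<^esub>" y] C.mult_l_distr[of "\<zero>\<^bsub>C\<^esub>" "\<zero>\<^bsub>C\<^esub>" y] that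
    by (simp_all add: C.M.add.l_cancel_one')
  have scal0: "h \<odot>\<^bsub>C\<^esub> \<zero>\<^bsub>C\<^esub> = \<zero>\<^bsub>C\<^esub>" "\<zero>\<^bsub>C\<^esub> \<odot>\<^sub>r\<^bsub>C\<^esub> h = \<zero>\<^bsub>C\<^esub>" if "h \<in> carrier H" for h
    using C.l_add[of h "\<zero>\<^bsub>C\<^esub>" "\<zero>\<^bsub>C\<^esub>"] C.r_add[of h "\<zero>\<^bsub>C\<^esub>" "\<zero>\<^bsub>C\<^esub>"] that
    by (simp_all add: C.M.add.l_cancel_one')
  have "additive_subgroup (a_kernel B C g) B"
    by (rule additive_subgroupI')
      (auto simp: a_kernel_def' zero neg alg_homD[OF g] B.M.abelian_group_axioms)
  thus ?thesis
    by (auto simp: alg_ideal_def a_kernel_def' alg_homD[OF g] mult0 scal0 alg_hom_closed[OF g])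
qed

lemma is_alg_sub:
  assumes B: "is_alg z H B" and I: "alg_ideal H B I"
  shows "is_alg z H (B\<lparr>carrier := I\<rparr>)"
proof -
  interpret B: h_algebra H B by (rule is_algD[OF B])
  interpret I: additive_subgroup I B using I by (simp add: alg_ideal_def)
  have sub: "x \<in> carrier B" if "x \<in> I" for x using that I.a_subset by blast
  have cl: "\<lbrakk>x \<in> I; b \<in> carrier B\<rbrakk> \<Longrightarrow> x \<otimes>\<^bsub>B\<^esub> b \<in> I"
    "\<lbrakk>x \<in> I; h \<in> carrier H\<rbrakk> \<Longrightarrow> h \<odot>\<^bsub>B\<^esub> x \<in> I" "\<lbrakk>x \<in> I; h \<in> carrier H\<rbrakk> \<Longrightarrow> x \<odot>\<^sub>r\<^bsub>B\<^esub> h \<in> I"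
    for x b h using I by (auto simp: alg_ideal_def)
  have neg: "\<ominus>\<^bsub>B\<^esub> x \<in> I" if "x \<in> I" for x
    using subgroup.m_inv_closed[OF I.a_subgroup that] by (simp add: a_inv_def)
  have "abelian_group (B\<lparr>carrier := I\<rparr>)"
  proof (rule abelian_groupI)
    show "\<exists>y\<in>carrier (B\<lparr>carrier := I\<rparr>). y \<oplus>\<^bsub>B\<lparr>carrier := I\<rparr>\<^esub> x = \<zero>\<^bsub>B\<lparr>carrier := I\<rparr>\<^esub>"
      if "x \<in> carrier (B\<lparr>carrier := I\<rparr>)" for x
      using neg[of x] that by (intro bexI[of _ "\<ominus>\<^bsub>B\<^esub> x"]) (auto simp: sub B.M.l_neg)
  qed (auto simp: sub B.M.a_assoc intro: B.M.a_comm)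
  hence "h_algebra H (B\<lparr>carrier := I\<rparr>)"
    by (intro h_algebra.intro bimodule.intro bimodule_axioms.intro h_algebra_axioms.intro
        B.H.ring_axioms)
      (auto simp: sub cl B.l_add_scal B.l_add B.l_assoc B.l_unit B.r_add_scal B.r_add B.r_assoc
        B.r_unit B.lr_assoc B.mult_assoc B.mult_l_distr B.mult_r_distr B.mult_l B.mult_r
        B.mult_balanced)
  moreover have "z \<longrightarrow> central H (B\<lparr>carrier := I\<rparr>)"
    using B sub by (auto simp: is_alg_def central_def)
  ultimately show ?thesis by (simp add: is_alg_def)
qed

theorem is_ker_universal:
  assumes A: "is_alg z H A" and B: "is_alg z H B" and D: "is_alg z H D"
    and f: "f \<in> alg_hom H A B" and ker: "is_ker A f B g C"
  shows "ker_test H A f B g C D"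
  unfolding ker_test_def
proof (intro ballI impI)
  fix d assume d: "d \<in> alg_hom H D B" and gd: "\<forall>x\<in>carrier D. g (d x) = \<zero>\<^bsub>C\<^esub>"
  interpret A: h_algebra H A by (rule is_algD[OF A])
  interpret D: h_algebra H D by (rule is_algD[OF D])
  have inj: "inj_on f (carrier A)" and im: "f ` carrier A = a_kernel B C g"
    using ker by (auto simp: is_ker_def bij_betw_def)
  define e where "e x = the_inv_into (carrier A) f (d x)" for x
  have d_im: "d x \<in> f ` carrier A" if "x \<in> carrier D" for x
    using that gd alg_hom_closed[OF d] by (simp add: im a_kernel_def')
  have e: "e x \<in> carrier A" "f (e x) = d x" if "x \<in> carrier D" for x
    using the_inv_into_into[OF inj d_im[OF that] order_refl] f_the_inv_into_f[OF inj d_im[OF that]]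
    by (simp_all add: e_def)
  have eqI: "a = b" if "a \<in> carrier A" "b \<in> carrier A" "f a = f b" for a b
    using inj that by (auto dest: inj_onD)
  have "e \<in> alg_hom H D A"
    by (rule alg_homI; (rule eqI)?) (simp_all add: e alg_homD[OF f] alg_homD[OF d])
  moreover have "\<forall>e' \<in> alg_hom H D A. (\<forall>x\<in>carrier D. f (e' x) = d x) \<longrightarrow> (\<forall>x\<in>carrier D. e' x = e x)"
    using e eqI alg_hom_closed by metis
  ultimately show "\<exists>e \<in> alg_hom H D A. (\<forall>x\<in>carrier D. f (e x) = d x) \<and>
      (\<forall>e' \<in> alg_hom H D A. (\<forall>x\<in>carrier D. f (e' x) = d x) \<longrightarrow> (\<forall>x\<in>carrier D. e' x = e x))"
    using e by blast
qed

theorem is_ker_iff_universal: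
  fixes A :: "('h, 'a) bimod" and B :: "('h, 'b) bimod"
  assumes A: "is_alg z H A" and B: "is_alg z H B" and C: "is_alg z H C"
    and f: "f \<in> alg_hom H A B" and g: "g \<in> alg_hom H B C"
  shows "is_ker A f B g C \<longleftrightarrow> (\<forall>x\<in>carrier A. g (f x) = \<zero>\<^bsub>C\<^esub>) \<and>
    (\<forall>D :: ('h, 'a) bimod. is_alg z H D \<longrightarrow> ker_test H A f B g C D) \<and>
    (\<forall>D :: ('h, 'b) bimod. is_alg z H D \<longrightarrow> ker_test H A f B g C D)"
proof
  assume ker: "is_ker A f B g C"
  hence "\<forall>x\<in>carrier A. g (f x) = \<zero>\<^bsub>C\<^esub>"
    by (auto simp: is_ker_def bij_betw_def a_kernel_def')
  thus "(\<forall>x\<in>carrier A. g (f x) = \<zero>\<^bsub>C\<^esub>) \<and>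
    (\<forall>D :: ('h, 'a) bimod. is_alg z H D \<longrightarrow> ker_test H A f B g C D) \<and>
    (\<forall>D :: ('h, 'b) bimod. is_alg z H D \<longrightarrow> ker_test H A f B g C D)"
    by (auto intro: is_ker_universal[OF A B _ f ker])
next
  assume *: "(\<forall>x\<in>carrier A. g (f x) = \<zero>\<^bsub>C\<^esub>) \<and>
    (\<forall>D :: ('h, 'a) bimod. is_alg z H D \<longrightarrow> ker_test H A f B g C D) \<and>
    (\<forall>D :: ('h, 'b) bimod. is_alg z H D \<longrightarrow> ker_test H A f B g C D)"
  define K where "K = B\<lparr>carrier := a_kernel B C g\<rparr>"
  have K: "is_alg z H K" unfolding K_def by (rule is_alg_sub[OF B alg_ideal_ker[OF B C g]])
  have cK: "x \<in> carrier K \<longleftrightarrow> x \<in> carrier B \<and> g x = \<zero>\<^bsub>C\<^esub>" for x by (simp add: K_def a_kernel_def')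
  have incl: "(\<lambda>x. x) \<in> alg_hom H K B" by (rule alg_homI) (auto simp: K_def a_kernel_def')
  have "ker_test H A f B g C K" using * K by blast
  from ker_test_ex[OF this incl] cK have "\<exists>e \<in> alg_hom H K A. \<forall>x\<in>carrier K. f (e x) = x"
    by simp
  then obtain e where e: "e \<in> alg_hom H K A" "\<And>x. x \<in> carrier K \<Longrightarrow> f (e x) = x"
    by (elim bexE) simp
  have fK: "f \<in> alg_hom H A K"
    using f * alg_hom_closed[OF f] by (auto simp: alg_hom_def K_def a_kernel_def')
  have "ker_test H A f B g C A" using * A by blast
  from ker_testD[OF this f _ alg_hom_comp[OF fK e(1)] alg_hom_id]
  have "e (f x) = x" if "x \<in> carrier A" for x
    using that * e(2) alg_hom_closed[OF fK] by simp
  thus "is_ker A f B g C"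
    unfolding is_ker_def
    by (intro bij_betw_byWitness[of _ e])
      (use e cK fK alg_hom_closed[OF fK] alg_hom_closed[OF e(1)] in \<open>auto simp: a_kernel_def'\<close>)
qed

lemma alg_ideal_ideal_gen:
  assumes B: "is_alg z H B" and S: "S \<subseteq> carrier B"
  shows "alg_ideal H B (ideal_gen H B S)" and "S \<subseteq> ideal_gen H B S"
proof -
  interpret B: h_algebra H B by (rule is_algD[OF B])
  have "alg_ideal H B (carrier B)"
    by (auto simp: alg_ideal_def intro!: additive_subgroupI' B.M.abelian_group_axioms)
  hence sub: "ideal_gen H B S \<subseteq> carrier B" using S by (auto simp: ideal_gen_def)
  have sg: "additive_subgroup I B" if "alg_ideal H B I" for I
    using that by (simp add: alg_ideal_def)
  have neg: "\<ominus>\<^bsub>B\<^esub> x \<in> I" if "x \<in> I" "alg_ideal H B I" for x I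
    using subgroup.m_inv_closed[OF additive_subgroup.a_subgroup[OF sg[OF that(2)]] that(1)]
    by (simp add: a_inv_def)
  have "additive_subgroup (ideal_gen H B S) B"
    by (rule additive_subgroupI'[OF B.M.abelian_group_axioms sub])
      (auto simp: ideal_gen_def neg
        intro: additive_subgroup.zero_closed[OF sg] additive_subgroup.a_closed[OF sg])
  thus "alg_ideal H B (ideal_gen H B S)"
    by (auto simp: alg_ideal_def[of H B "ideal_gen H B S"]) (auto simp: ideal_gen_def alg_ideal_def)
  show "S \<subseteq> ideal_gen H B S" by (auto simp: ideal_gen_def)
qed

definition cong_mod :: "('h, 'b) bimod \<Rightarrow> 'b set \<Rightarrow> ('b \<times> 'b) set" where
  "cong_mod B I = {(x, y). x \<in> carrier B \<and> y \<in> carrier B \<and> x \<oplus>\<^bsub>B\<^esub> \<ominus>\<^bsub>B\<^esub> y \<in> I}"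

lemma cong_mod_congruence:
  assumes B: "is_alg z H B" and I: "alg_ideal H B I"
  shows "alg_congruence H B (cong_mod B I)"
proof -
  interpret B: h_algebra H B by (rule is_algD[OF B])
  interpret I: additive_subgroup I B using I by (simp add: alg_ideal_def)
  have neg_I: "\<ominus>\<^bsub>B\<^esub> x \<in> I" if "x \<in> I" for x
    using subgroup.m_inv_closed[OF I.a_subgroup that] by (simp add: a_inv_def)
  have cl: "\<lbrakk>x \<in> I; b \<in> carrier B\<rbrakk> \<Longrightarrow> x \<otimes>\<^bsub>B\<^esub> b \<in> I" "\<lbrakk>x \<in> I; b \<in> carrier B\<rbrakk> \<Longrightarrow> b \<otimes>\<^bsub>B\<^esub> x \<in> I"
    "\<lbrakk>x \<in> I; h \<in> carrier H\<rbrakk> \<Longrightarrow> h \<odot>\<^bsub>B\<^esub> x \<in> I" "\<lbrakk>x \<in> I; h \<in> carrier H\<rbrakk> \<Longrightarrow> x \<odot>\<^sub>r\<^bsub>B\<^esub> h \<in> I"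
    for x b h using I by (auto simp: alg_ideal_def)
  have iff: "(x, y) \<in> cong_mod B I \<longleftrightarrow> (\<exists>i\<in>I. x = i \<oplus>\<^bsub>B\<^esub> y)"
    if "x \<in> carrier B" "y \<in> carrier B" for x y
  proof
    assume "(x, y) \<in> cong_mod B I"
    thus "\<exists>i\<in>I. x = i \<oplus>\<^bsub>B\<^esub> y"
      using that by (intro bexI[of _ "x \<oplus>\<^bsub>B\<^esub> \<ominus>\<^bsub>B\<^esub> y"]) (auto simp: cong_mod_def B.M.a_assoc B.M.l_neg)
  next
    assume "\<exists>i\<in>I. x = i \<oplus>\<^bsub>B\<^esub> y"
    thus "(x, y) \<in> cong_mod B I"
      using that by (auto simp: cong_mod_def B.M.a_assoc B.M.r_neg)
  qed
  have mk: "(x, y) \<in> cong_mod B I" if "x = i \<oplus>\<^bsub>B\<^esub> y" "i \<in> I" "y \<in> carrier B" for x y i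
    using that iff[of x y] I.a_subset by auto
  have sub: "x \<in> carrier B \<and> y \<in> carrier B" if "(x, y) \<in> cong_mod B I" for x y
    using that by (simp add: cong_mod_def)
  have E: "\<exists>i\<in>I. x = i \<oplus>\<^bsub>B\<^esub> y \<and> i \<in> carrier B \<and> x \<in> carrier B \<and> y \<in> carrier B"
    if "(x, y) \<in> cong_mod B I" for x y
    using iff that sub[OF that] I.a_subset by blast
  show ?thesis
  proof (rule alg_congruence.intro)
    show "ring H" by (rule B.H.ring_axioms)
    show "equiv (carrier B) (cong_mod B I)"
    proof (rule equivI)
      show "cong_mod B I \<subseteq> carrier B \<times> carrier B" by (auto simp: cong_mod_def)
      show "refl_on (carrier B) (cong_mod B I)"
        by (auto simp: refl_on_def cong_mod_def B.M.r_neg)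
      show "sym (cong_mod B I)"
      proof (rule symI)
        fix x y assume "(x, y) \<in> cong_mod B I"
        from E[OF this] obtain i where i: "i \<in> I" "i \<in> carrier B" "x = i \<oplus>\<^bsub>B\<^esub> y"
          "x \<in> carrier B" "y \<in> carrier B" by blast
        have "y = \<ominus>\<^bsub>B\<^esub> i \<oplus>\<^bsub>B\<^esub> x"
          using i by (simp add: B.M.a_assoc[symmetric] B.M.l_neg)
        thus "(y, x) \<in> cong_mod B I" by (rule mk[OF _ neg_I[OF i(1)] i(4)])
      qed
      show "trans (cong_mod B I)"
      proof (rule transI)
        fix x y w assume xy: "(x, y) \<in> cong_mod B I" and yw: "(y, w) \<in> cong_mod B I"
        from E[OF xy] obtain i where i: "i \<in> I" "i \<in> carrier B" "x = i \<oplus>\<^bsub>B\<^esub> y" "x \<in> carrier B"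
          by blast
        from E[OF yw] obtain j where j: "j \<in> I" "j \<in> carrier B" "y = j \<oplus>\<^bsub>B\<^esub> w" "w \<in> carrier B"
          by blast
        have "x = (i \<oplus>\<^bsub>B\<^esub> j) \<oplus>\<^bsub>B\<^esub> w" using i j by (simp add: B.M.a_assoc)
        thus "(x, w) \<in> cong_mod B I" by (rule mk[OF _ I.a_closed[OF i(1) j(1)] j(4)])
      qed
    qed
    show "\<zero>\<^bsub>B\<^esub> \<in> carrier B" by simp
    fix x x' assume xx: "(x, x') \<in> cong_mod B I"
    from E[OF xx] obtain i where i: "i \<in> I" "i \<in> carrier B" "x = i \<oplus>\<^bsub>B\<^esub> x'" "x \<in> carrier B"
      "x' \<in> carrier B" by blast
    {
      fix y y' assume yy: "(y, y') \<in> cong_mod B I"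
      from E[OF yy] obtain j where j: "j \<in> I" "j \<in> carrier B" "y = j \<oplus>\<^bsub>B\<^esub> y'" "y \<in> carrier B"
        "y' \<in> carrier B" by blast
      have "x \<oplus>\<^bsub>B\<^esub> y = (i \<oplus>\<^bsub>B\<^esub> j) \<oplus>\<^bsub>B\<^esub> (x' \<oplus>\<^bsub>B\<^esub> y')" using i j by (simp add: B.M.a_ac)
      thus "(x \<oplus>\<^bsub>B\<^esub> y, x' \<oplus>\<^bsub>B\<^esub> y') \<in> cong_mod B I"
        by (rule mk[OF _ I.a_closed[OF i(1) j(1)] B.M.a_closed[OF i(5) j(5)]])
      have "x \<otimes>\<^bsub>B\<^esub> y = (i \<otimes>\<^bsub>B\<^esub> y \<oplus>\<^bsub>B\<^esub> x' \<otimes>\<^bsub>B\<^esub> j) \<oplus>\<^bsub>B\<^esub> (x' \<otimes>\<^bsub>B\<^esub> y')"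
        using i j by (simp add: B.mult_l_distr B.mult_r_distr B.M.a_ac)
      moreover have "i \<otimes>\<^bsub>B\<^esub> y \<oplus>\<^bsub>B\<^esub> x' \<otimes>\<^bsub>B\<^esub> j \<in> I" using i j cl by simp
      ultimately show "(x \<otimes>\<^bsub>B\<^esub> y, x' \<otimes>\<^bsub>B\<^esub> y') \<in> cong_mod B I"
        by (rule mk[OF _ _ B.mult_closed[OF i(5) j(5)]])
    next
      fix h assume h: "h \<in> carrier H"
      have "h \<odot>\<^bsub>B\<^esub> x = h \<odot>\<^bsub>B\<^esub> i \<oplus>\<^bsub>B\<^esub> h \<odot>\<^bsub>B\<^esub> x'" using h i by (simp add: B.l_add)
      thus "(h \<odot>\<^bsub>B\<^esub> x, h \<odot>\<^bsub>B\<^esub> x') \<in> cong_mod B I"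
        by (rule mk[OF _ cl(3)[OF i(1) h] B.l_closed[OF h i(5)]])
      have "x \<odot>\<^sub>r\<^bsub>B\<^esub> h = i \<odot>\<^sub>r\<^bsub>B\<^esub> h \<oplus>\<^bsub>B\<^esub> x' \<odot>\<^sub>r\<^bsub>B\<^esub> h" using h i by (simp add: B.r_add)
      thus "(x \<odot>\<^sub>r\<^bsub>B\<^esub> h, x' \<odot>\<^sub>r\<^bsub>B\<^esub> h) \<in> cong_mod B I"
        by (rule mk[OF _ cl(4)[OF i(1) h] B.r_closed[OF h i(5)]])
    }
  qed
qed

lemma is_alg_quot_ideal:
  assumes B: "is_alg z H B" and I: "alg_ideal H B I"
  shows "is_alg z H (quot B (cong_mod B I))"
proof -
  interpret B: h_algebra H B by (rule is_algD[OF B])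
  interpret alg_congruence H B "cong_mod B I" by (rule cong_mod_congruence[OF B I])
  have eq: "(x, y) \<in> cong_mod B I" if "x = y" "y \<in> carrier B" for x y
    using that equiv by (auto simp: equiv_def refl_on_def)
  have neg: "\<exists>y\<in>carrier B. (y \<oplus>\<^bsub>B\<^esub> x, \<zero>\<^bsub>B\<^esub>) \<in> cong_mod B I" if "x \<in> carrier B" for x
    using that by (intro bexI[of _ "\<ominus>\<^bsub>B\<^esub> x"] eq) (auto simp: B.M.l_neg)
  have "h \<odot>\<^bsub>B\<^esub> x = x \<odot>\<^sub>r\<^bsub>B\<^esub> h" if "z" "h \<in> carrier H" "x \<in> carrier B" for h x
    using B that by (auto simp: is_alg_def central_def)
  thus ?thesis
    by (intro is_alg_quot neg eq)
      (simp_all add: B.M.a_ac B.l_add_scal B.l_add B.l_assoc B.l_unit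
        B.r_add_scal B.r_add B.r_assoc B.r_unit B.lr_assoc B.mult_assoc B.mult_l_distr
        B.mult_r_distr B.mult_l B.mult_r B.mult_balanced)
qed

lemma ker_diff:
  assumes B: "is_alg z H B" and C: "is_alg z H C" and g: "g \<in> alg_hom H B C"
    and "x \<in> carrier B" "y \<in> carrier B"
  shows "g x = g y \<longleftrightarrow> x \<oplus>\<^bsub>B\<^esub> \<ominus>\<^bsub>B\<^esub> y \<in> a_kernel B C g"
proof -
  interpret B: abelian_group B by (rule is_alg_group[OF B])
  interpret C: abelian_group C by (rule is_alg_group[OF C])
  have eq: "g (x \<oplus>\<^bsub>B\<^esub> \<ominus>\<^bsub>B\<^esub> y) = g x \<oplus>\<^bsub>C\<^esub> \<ominus>\<^bsub>C\<^esub> g y"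
    using assms(4,5) alg_homD(1)[OF g]
      alg_hom_neg[OF B.abelian_group_axioms C.abelian_group_axioms g] by simp
  have gc: "g x \<in> carrier C" "g y \<in> carrier C"
    using alg_hom_closed[OF g] assms(4,5) by auto
  have "g x \<oplus>\<^bsub>C\<^esub> \<ominus>\<^bsub>C\<^esub> g y = \<zero>\<^bsub>C\<^esub> \<longleftrightarrow> g x = g y"
  proof
    assume "g x \<oplus>\<^bsub>C\<^esub> \<ominus>\<^bsub>C\<^esub> g y = \<zero>\<^bsub>C\<^esub>"
    from C.minus_equality[OF this] gc show "g x = g y" by simp
  qed (use gc in \<open>simp add: C.r_neg\<close>)
  with eq show ?thesis using assms(4,5) B.a_inv_closed by (simp add: a_kernel_def')
qed

theorem is_coker_universal:
  assumes B: "is_alg z H B" and C: "is_alg z H C" and D: "is_alg z H D"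
    and f: "f \<in> alg_hom H A B" and g: "g \<in> alg_hom H B C" and coker: "is_coker H A f B g C"
  shows "coker_test H A f B g C D"
  unfolding coker_test_def
proof (intro ballI impI)
  fix d assume d: "d \<in> alg_hom H B D" and df: "\<forall>x\<in>carrier A. d (f x) = \<zero>\<^bsub>D\<^esub>"
  interpret B: h_algebra H B by (rule is_algD[OF B])
  interpret C: h_algebra H C by (rule is_algD[OF C])
  have surj: "g ` carrier B = carrier C"
    and im: "a_kernel B C g = ideal_gen H B (f ` carrier A)"
    using coker by (auto simp: is_coker_def)
  have "f ` carrier A \<subseteq> a_kernel B D d" using df alg_hom_closed[OF f] by (auto simp: a_kernel_def')
  hence sub: "a_kernel B C g \<subseteq> a_kernel B D d"
    using alg_ideal_ker[OF B D d] by (auto simp: im ideal_gen_def)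
  have wd: "d x = d y" if "x \<in> carrier B" "y \<in> carrier B" "g x = g y" for x y
    using ker_diff[OF B C g that(1,2)] ker_diff[OF B D d that(1,2)] that(3) sub by blast
  define b where "b y = (SOME x. x \<in> carrier B \<and> g x = y)" for y
  have b: "b y \<in> carrier B" "g (b y) = y" if "y \<in> carrier C" for y
  proof -
    have "\<exists>x. x \<in> carrier B \<and> g x = y" using that surj by (metis imageE)
    from someI_ex[OF this] show "b y \<in> carrier B" "g (b y) = y" by (simp_all add: b_def)
  qed
  have e: "d (b (g x)) = d x" if "x \<in> carrier B" for x
    using that b alg_hom_closed[OF g] by (intro wd) auto
  have "(\<lambda>y. d (b y)) \<in> alg_hom H C D"
  proof (rule alg_homI)
    show "d (b x) \<in> carrier D" if "x \<in> carrier C" for x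
      using that b alg_hom_closed[OF d] by blast
    show "d (b (x \<oplus>\<^bsub>C\<^esub> y)) = d (b x) \<oplus>\<^bsub>D\<^esub> d (b y)" if "x \<in> carrier C" "y \<in> carrier C" for x y
      using e[of "b x \<oplus>\<^bsub>B\<^esub> b y"] b that by (simp add: alg_homD[OF g] alg_homD[OF d])
    show "d (b (x \<otimes>\<^bsub>C\<^esub> y)) = d (b x) \<otimes>\<^bsub>D\<^esub> d (b y)" if "x \<in> carrier C" "y \<in> carrier C" for x y
      using e[of "b x \<otimes>\<^bsub>B\<^esub> b y"] b that by (simp add: alg_homD[OF g] alg_homD[OF d])
    show "d (b (h \<odot>\<^bsub>C\<^esub> x)) = h \<odot>\<^bsub>D\<^esub> d (b x)" if "h \<in> carrier H" "x \<in> carrier C" for h x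
      using e[of "h \<odot>\<^bsub>B\<^esub> b x"] b that by (simp add: alg_homD[OF g] alg_homD[OF d])
    show "d (b (x \<odot>\<^sub>r\<^bsub>C\<^esub> h)) = d (b x) \<odot>\<^sub>r\<^bsub>D\<^esub> h" if "h \<in> carrier H" "x \<in> carrier C" for h x
      using e[of "b x \<odot>\<^sub>r\<^bsub>B\<^esub> h"] b that by (simp add: alg_homD[OF g] alg_homD[OF d])
  qed
  moreover have "e' y = d (b y)" if "\<forall>x\<in>carrier B. e' (g x) = d x" "y \<in> carrier C" for e' y
    using that b by metis
  ultimately show "\<exists>e \<in> alg_hom H C D. (\<forall>x\<in>carrier B. e (g x) = d x) \<and>
      (\<forall>e' \<in> alg_hom H C D. (\<forall>x\<in>carrier B. e' (g x) = d x) \<longrightarrow> (\<forall>y\<in>carrier C. e' y = e y))"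
    using e by (intro bexI[of _ "\<lambda>y. d (b y)"]) auto
qed

theorem is_coker_iff_universal:
  fixes B :: "('h, 'b) bimod" and C :: "('h, 'c) bimod"
  assumes B: "is_alg z H B" and C: "is_alg z H C"
    and f: "f \<in> alg_hom H A B" and g: "g \<in> alg_hom H B C"
  shows "is_coker H A f B g C \<longleftrightarrow> (\<forall>x\<in>carrier A. g (f x) = \<zero>\<^bsub>C\<^esub>) \<and>
    (\<forall>D :: ('h, 'c) bimod. is_alg z H D \<longrightarrow> coker_test H A f B g C D) \<and>
    (\<forall>D :: ('h, 'b set) bimod. is_alg z H D \<longrightarrow> coker_test H A f B g C D)"
proof
  assume coker: "is_coker H A f B g C"
  have "f ` carrier A \<subseteq> carrier B" using alg_hom_closed[OF f] by auto
  hence "\<forall>x\<in>carrier A. g (f x) = \<zero>\<^bsub>C\<^esub>"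
    using coker alg_ideal_ideal_gen(2)[OF B, of "f ` carrier A"]
    by (auto simp: is_coker_def a_kernel_def')
  thus "(\<forall>x\<in>carrier A. g (f x) = \<zero>\<^bsub>C\<^esub>) \<and>
    (\<forall>D :: ('h, 'c) bimod. is_alg z H D \<longrightarrow> coker_test H A f B g C D) \<and>
    (\<forall>D :: ('h, 'b set) bimod. is_alg z H D \<longrightarrow> coker_test H A f B g C D)"
    by (auto intro: is_coker_universal[OF B C _ f g coker])
next
  assume *: "(\<forall>x\<in>carrier A. g (f x) = \<zero>\<^bsub>C\<^esub>) \<and>
    (\<forall>D :: ('h, 'c) bimod. is_alg z H D \<longrightarrow> coker_test H A f B g C D) \<and>
    (\<forall>D :: ('h, 'b set) bimod. is_alg z H D \<longrightarrow> coker_test H A f B g C D)"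
  interpret B: h_algebra H B by (rule is_algD[OF B])
  interpret C: h_algebra H C by (rule is_algD[OF C])
  define I where "I = ideal_gen H B (f ` carrier A)"
  define Q where "Q = quot B (cong_mod B I)"
  have fB: "f ` carrier A \<subseteq> carrier B" using alg_hom_closed[OF f] by auto
  have I: "alg_ideal H B I" and fI: "f ` carrier A \<subseteq> I"
    using alg_ideal_ideal_gen[OF B fB] by (simp_all add: I_def)
  interpret alg_congruence H B "cong_mod B I" by (rule cong_mod_congruence[OF B I])
  define p where "p = (\<lambda>x. cong_mod B I `` {x})"
  have Q: "is_alg z H Q" unfolding Q_def by (rule is_alg_quot_ideal[OF B I])
  have p: "p \<in> alg_hom H B Q" unfolding Q_def p_def by (rule class_hom)
  have p0: "p x = \<zero>\<^bsub>Q\<^esub> \<longleftrightarrow> x \<in> I" if "x \<in> carrier B" for x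
  proof -
    have "p x = \<zero>\<^bsub>Q\<^esub> \<longleftrightarrow> (x, \<zero>\<^bsub>B\<^esub>) \<in> cong_mod B I"
      using class_eqD[of x "\<zero>\<^bsub>B\<^esub>"] class_eq[of x "\<zero>\<^bsub>B\<^esub>"] by (auto simp: Q_def p_def quot_ops)
    moreover have "\<ominus>\<^bsub>B\<^esub> \<zero>\<^bsub>B\<^esub> = \<zero>\<^bsub>B\<^esub>" using B.M.add.inv_one by (simp add: a_inv_def)
    ultimately show ?thesis using that by (simp add: cong_mod_def)
  qed
  have ker_p: "a_kernel B Q p = I"
    using p0 I additive_subgroup.a_subset[of I B] by (auto simp: a_kernel_def' alg_ideal_def)
  have surj_p: "p ` carrier B = carrier Q" by (auto simp: Q_def p_def quot_def quotient_def)
  have coker_p: "is_coker H A f B p Q"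
    using surj_p ker_p by (simp add: is_coker_def I_def)
  have "coker_test H A f B g C Q" using * Q by blast
  moreover have "p (f x) = \<zero>\<^bsub>Q\<^esub>" if "x \<in> carrier A" for x using p0 fI fB that by blast
  ultimately have "\<exists>e \<in> alg_hom H C Q. \<forall>x\<in>carrier B. e (g x) = p x"
    by (rule coker_test_ex[OF _ p])
  then obtain e where e: "e \<in> alg_hom H C Q" "\<And>x. x \<in> carrier B \<Longrightarrow> e (g x) = p x"
    by (elim bexE) simp
  have "coker_test H A f B p Q C" by (rule is_coker_universal[OF B Q C f p coker_p])
  moreover have "g (f x) = \<zero>\<^bsub>C\<^esub>" if "x \<in> carrier A" for x using * that by blast
  ultimately have "\<exists>r \<in> alg_hom H Q C. \<forall>x\<in>carrier B. r (p x) = g x"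
    by (rule coker_test_ex[OF _ g])
  then obtain r where r: "r \<in> alg_hom H Q C" "\<And>x. x \<in> carrier B \<Longrightarrow> r (p x) = g x"
    by (elim bexE) simp
  have "coker_test H A f B g C C" using * C by blast
  from coker_testD[OF this g _ alg_hom_comp[OF e(1) r(1)] alg_hom_id]
  have re: "r (e y) = y" if "y \<in> carrier C" for y
    using that * e(2) r(2) by simp
  have "y \<in> g ` carrier B" if "y \<in> carrier C" for y
  proof -
    have "e y \<in> p ` carrier B" using alg_hom_closed[OF e(1) that] surj_p by simp
    then obtain x where "x \<in> carrier B" "e y = p x" by blast
    thus ?thesis using re[OF that] r(2) by auto
  qed
  hence "g ` carrier B = carrier C" using alg_hom_closed[OF g] by auto
  moreover have "a_kernel B C g = I"
  proof
    show "a_kernel B C g \<subseteq> I"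
    proof
      fix x assume "x \<in> a_kernel B C g"
      hence x: "x \<in> carrier B" "g x = \<zero>\<^bsub>C\<^esub>" by (auto simp: a_kernel_def')
      hence "p x = \<zero>\<^bsub>Q\<^esub>"
        using e alg_hom_zero[OF is_alg_group[OF C] is_alg_group[OF Q] e(1)] by metis
      thus "x \<in> I" using p0 x by blast
    qed
    have "f ` carrier A \<subseteq> a_kernel B C g" using * fB by (auto simp: a_kernel_def')
    thus "I \<subseteq> a_kernel B C g" using alg_ideal_ker[OF B C g] by (auto simp: I_def ideal_gen_def)
  qed
  ultimately show "is_coker H A f B g C" by (simp add: is_coker_def I_def)
qed

end

theory Submission
  imports Defs
begin

text \<open>
  Write \<open>\<eta> : T \<rightarrow> C\<close> for the counit and \<open>e : C \<rightarrow> T\<close> for the inclusion of the generators. The sequence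
  \<open>J \<rightarrow> T \<rightarrow> C\<close> is an extension because \<open>\<eta>\<close> is split by \<open>e\<close> and a kernel, being an ideal, generates
  itself. A section \<open>s\<close> of \<open>g\<close> in the underlying category extends to a homomorphism \<open>\<phi> : T \<rightarrow> B\<close>, and
  \<open>g \<phi> = \<eta>\<close> because the two sides agree on generators; so \<open>\<phi>\<close> maps \<open>J\<close> into the kernel of \<open>g\<close>, which
  gives \<open>\<xi>\<close>.

  For uniqueness, let \<open>\<phi>, \<phi>' : T \<rightarrow> B\<close> be two lifts of \<open>\<eta>\<close>. The map
  \<open>c \<mapsto> (1 - t) \<phi>(e c) + t \<phi>'(e c)\<close> from \<open>C\<close> to \<open>B[t]\<close> is in general not multiplicative, but it is a morphism in
  the underlying category, and so it extends to a homomorphism \<open>\<Phi> : T \<rightarrow> B[t]\<close> with \<open>ev\<^sub>0 \<Phi> = \<phi>\<close> and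
  \<open>ev\<^sub>1 \<Phi> = \<phi>'\<close> (\<open>free_alg_homotopy\<close>). Applying \<open>g\<close> to coefficients, the segment from \<open>\<phi>(e c)\<close> to
  \<open>\<phi>'(e c)\<close> becomes the constant polynomial \<open>c\<close>. Hence \<open>g[t] \<Phi>\<close> is \<open>\<eta>\<close> followed by the inclusion of
  the constants, and \<open>\<Phi>\<close> maps \<open>J\<close> into the kernel of \<open>g[t]\<close>, which is \<open>A[t]\<close> (\<open>poly_map_ker\<close>). The
  resulting \<open>J \<rightarrow> A[t]\<close> is the homotopy between \<open>\<xi>\<close> and \<open>\<xi>'\<close>.

  The extension to \<open>T\<close> and its uniqueness rest on \<open>B[t]\<close> being an algebra (\<open>is_alg_poly\<close>) and on
  evaluation being a homomorphism (\<open>poly_ev_hom\<close>). As \<open>B\<close> need not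
  have a unit, both are obtained from sums over triangles in an abelian group.
\<close>

section \<open>Finite sums\<close>

lemma additive_finsum:
  assumes G: "abelian_group G" and K: "abelian_group K"
    and closed: "\<And>x. x \<in> carrier G \<Longrightarrow> f x \<in> carrier K"
    and add: "\<And>x y. \<lbrakk>x \<in> carrier G; y \<in> carrier G\<rbrakk> \<Longrightarrow> f (x \<oplus>\<^bsub>G\<^esub> y) = f x \<oplus>\<^bsub>K\<^esub> f y"
    and p: "p \<in> I \<rightarrow> carrier G"
  shows "f (\<Oplus>\<^bsub>G\<^esub>i\<in>I. p i) = (\<Oplus>\<^bsub>K\<^esub>i\<in>I. f (p i))"
proof -
  interpret G: abelian_group G by fact
  interpret K: abelian_group K by fact
  have "f \<zero>\<^bsub>G\<^esub> \<oplus>\<^bsub>K\<^esub> f \<zero>\<^bsub>G\<^esub> = f \<zero>\<^bsub>G\<^esub>" using add[of "\<zero>\<^bsub>G\<^esub>" "\<zero>\<^bsub>G\<^esub>"] by simp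
  hence zero: "f \<zero>\<^bsub>G\<^esub> = \<zero>\<^bsub>K\<^esub>" using closed[of "\<zero>\<^bsub>G\<^esub>"] by (metis G.zero_closed K.add.l_cancel_one')
  show ?thesis
    using p
  proof (induction I rule: infinite_finite_induct)
    case (insert i I)
    then show ?case by (simp add: add closed Pi_def)
  qed (simp_all add: zero)
qed

lemma additive_add_pow:
  assumes G: "abelian_group G" and K: "abelian_group K"
    and closed: "\<And>x. x \<in> carrier G \<Longrightarrow> f x \<in> carrier K"
    and add: "\<And>x y. \<lbrakk>x \<in> carrier G; y \<in> carrier G\<rbrakk> \<Longrightarrow> f (x \<oplus>\<^bsub>G\<^esub> y) = f x \<oplus>\<^bsub>K\<^esub> f y"
    and x: "x \<in> carrier G"
  shows "f ([(n::nat)] \<cdot>\<^bsub>G\<^esub> x) = ([n] \<cdot>\<^bsub>K\<^esub> f x)"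
proof -
  interpret G: abelian_group G by fact
  interpret K: abelian_group K by fact
  show ?thesis
    using additive_finsum[OF G K closed add, of "\<lambda>_. x" "{..<n}"] x closed
    by (simp add: G.add.finprod_const K.add.finprod_const)
qed

text \<open>
  Summation by antidiagonals equals summation by rows. With \<open>F i j = (p\<^sub>i q\<^sub>j) r\<^sub>n\<^sub>-\<^sub>i\<^sub>-\<^sub>j\<close> this is the
  associativity of polynomial multiplication, with \<open>F i j = p\<^sub>i q\<^sub>j\<close> the Cauchy product formula.
\<close>

lemma (in abelian_monoid) finsum_triangle:
  assumes F: "\<And>i j. F i j \<in> carrier G"
  shows "(\<Oplus>k\<in>{..n::nat}. \<Oplus>i\<in>{..k}. F i (k - i)) = (\<Oplus>i\<in>{..n}. \<Oplus>j\<in>{..n - i}. F i j)"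
proof (induction n)
  case 0
  then show ?case by (simp add: F)
next
  case (Suc n)
  have "(\<Oplus>i\<in>{..n}. \<Oplus>j\<in>{..Suc n - i}. F i j) =
      (\<Oplus>i\<in>{..n}. F i (Suc n - i) \<oplus> (\<Oplus>j\<in>{..n - i}. F i j))"
    by (rule finsum_cong') (auto simp: F Suc_diff_le)
  also have "\<dots> = (\<Oplus>i\<in>{..n}. F i (Suc n - i)) \<oplus> (\<Oplus>i\<in>{..n}. \<Oplus>j\<in>{..n - i}. F i j)"
    by (rule finsum_addf) (auto simp: F)
  finally show ?case by (simp add: F Suc.IH[symmetric] a_assoc)
qed

lemma (in abelian_monoid) finsum_extend:
  assumes "(m::nat) \<le> n" and p: "\<And>i. p i \<in> carrier G" and "\<And>i. m < i \<Longrightarrow> p i = \<zero>"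
  shows "(\<Oplus>i\<in>{..n}. p i) = (\<Oplus>i\<in>{..m}. p i)"
  by (rule add.finprod_mono_neutral_cong_right) (use assms in auto)

context h_algebra
begin

lemma mult_zero [simp]:
  "x \<in> carrier A \<Longrightarrow> x \<otimes>\<^bsub>A\<^esub> \<zero>\<^bsub>A\<^esub> = \<zero>\<^bsub>A\<^esub>" "x \<in> carrier A \<Longrightarrow> \<zero>\<^bsub>A\<^esub> \<otimes>\<^bsub>A\<^esub> x = \<zero>\<^bsub>A\<^esub>"
  using mult_r_distr[of "\<zero>\<^bsub>A\<^esub>" "\<zero>\<^bsub>A\<^esub>" x] mult_l_distr[of "\<zero>\<^bsub>A\<^esub>" "\<zero>\<^bsub>A\<^esub>" x]
  by (simp_all add: M.add.l_cancel_one')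

lemma scal_zero [simp]:
  "h \<in> carrier H \<Longrightarrow> h \<odot>\<^bsub>A\<^esub> \<zero>\<^bsub>A\<^esub> = \<zero>\<^bsub>A\<^esub>" "h \<in> carrier H \<Longrightarrow> \<zero>\<^bsub>A\<^esub> \<odot>\<^sub>r\<^bsub>A\<^esub> h = \<zero>\<^bsub>A\<^esub>"
  using l_add[of h "\<zero>\<^bsub>A\<^esub>" "\<zero>\<^bsub>A\<^esub>"] r_add[of h "\<zero>\<^bsub>A\<^esub>" "\<zero>\<^bsub>A\<^esub>"]
  by (simp_all add: M.add.l_cancel_one')

lemma finsum_mult:
  assumes "p \<in> I \<rightarrow> carrier A" and "x \<in> carrier A"
  shows "(\<Oplus>\<^bsub>A\<^esub>i\<in>I. p i) \<otimes>\<^bsub>A\<^esub> x = (\<Oplus>\<^bsub>A\<^esub>i\<in>I. p i \<otimes>\<^bsub>A\<^esub> x)"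
    and "x \<otimes>\<^bsub>A\<^esub> (\<Oplus>\<^bsub>A\<^esub>i\<in>I. p i) = (\<Oplus>\<^bsub>A\<^esub>i\<in>I. x \<otimes>\<^bsub>A\<^esub> p i)"
  using assms additive_finsum[OF M.abelian_group_axioms M.abelian_group_axioms _ _ assms(1),
      of "\<lambda>y. y \<otimes>\<^bsub>A\<^esub> x"]
    additive_finsum[OF M.abelian_group_axioms M.abelian_group_axioms _ _ assms(1),
      of "\<lambda>y. x \<otimes>\<^bsub>A\<^esub> y"]
  by (simp_all add: mult_l_distr mult_r_distr)

lemma finsum_scal:
  assumes "p \<in> I \<rightarrow> carrier A" and "h \<in> carrier H"
  shows "h \<odot>\<^bsub>A\<^esub> (\<Oplus>\<^bsub>A\<^esub>i\<in>I. p i) = (\<Oplus>\<^bsub>A\<^esub>i\<in>I. h \<odot>\<^bsub>A\<^esub> p i)"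
    and "(\<Oplus>\<^bsub>A\<^esub>i\<in>I. p i) \<odot>\<^sub>r\<^bsub>A\<^esub> h = (\<Oplus>\<^bsub>A\<^esub>i\<in>I. p i \<odot>\<^sub>r\<^bsub>A\<^esub> h)"
  using assms additive_finsum[OF M.abelian_group_axioms M.abelian_group_axioms _ _ assms(1),
      of "\<lambda>y. h \<odot>\<^bsub>A\<^esub> y"]
    additive_finsum[OF M.abelian_group_axioms M.abelian_group_axioms _ _ assms(1),
      of "\<lambda>y. y \<odot>\<^sub>r\<^bsub>A\<^esub> h"]
  by (simp_all add: l_add r_add)

lemma add_pow_mult:
  assumes "x \<in> carrier A" and "y \<in> carrier A"
  shows "([(m::nat)] \<cdot>\<^bsub>A\<^esub> x) \<otimes>\<^bsub>A\<^esub> ([(n::nat)] \<cdot>\<^bsub>A\<^esub> y) = ([(m * n)] \<cdot>\<^bsub>A\<^esub> (x \<otimes>\<^bsub>A\<^esub> y))"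
proof -
  note A = M.abelian_group_axioms
  have "([m] \<cdot>\<^bsub>A\<^esub> x) \<otimes>\<^bsub>A\<^esub> ([n] \<cdot>\<^bsub>A\<^esub> y) = ([m] \<cdot>\<^bsub>A\<^esub> (x \<otimes>\<^bsub>A\<^esub> ([n] \<cdot>\<^bsub>A\<^esub> y)))"
    using assms by (intro additive_add_pow[OF A A]) (auto simp: mult_l_distr)
  also have "x \<otimes>\<^bsub>A\<^esub> ([n] \<cdot>\<^bsub>A\<^esub> y) = ([n] \<cdot>\<^bsub>A\<^esub> (x \<otimes>\<^bsub>A\<^esub> y))"
    using assms by (intro additive_add_pow[OF A A]) (auto simp: mult_r_distr)
  finally show ?thesis using assms by (simp add: M.add.nat_pow_pow mult.commute)
qed

lemma cauchy_product:
  assumes p: "\<And>i::nat. p i \<in> carrier A" "\<And>i. m < i \<Longrightarrow> p i = \<zero>\<^bsub>A\<^esub>"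
    and q: "\<And>j::nat. q j \<in> carrier A" "\<And>j. n < j \<Longrightarrow> q j = \<zero>\<^bsub>A\<^esub>"
  shows "(\<Oplus>\<^bsub>A\<^esub>k\<in>{..m + n}. \<Oplus>\<^bsub>A\<^esub>i\<in>{..k}. p i \<otimes>\<^bsub>A\<^esub> q (k - i)) =
    (\<Oplus>\<^bsub>A\<^esub>i\<in>{..m}. p i) \<otimes>\<^bsub>A\<^esub> (\<Oplus>\<^bsub>A\<^esub>j\<in>{..n}. q j)"
proof -
  let ?Q = "\<Oplus>\<^bsub>A\<^esub>j\<in>{..n}. q j"
  have Q: "?Q \<in> carrier A" using q by simp
  have "(\<Oplus>\<^bsub>A\<^esub>k\<in>{..m + n}. \<Oplus>\<^bsub>A\<^esub>i\<in>{..k}. p i \<otimes>\<^bsub>A\<^esub> q (k - i)) =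
      (\<Oplus>\<^bsub>A\<^esub>i\<in>{..m + n}. \<Oplus>\<^bsub>A\<^esub>j\<in>{..m + n - i}. p i \<otimes>\<^bsub>A\<^esub> q j)"
    by (rule M.finsum_triangle[of "\<lambda>i j. p i \<otimes>\<^bsub>A\<^esub> q j"]) (simp add: p q)
  \<comment> \<open>Row \<open>i\<close> either contains the whole support of \<open>q\<close> or has the factor \<open>p i = 0\<close>.\<close>
  also have "\<dots> = (\<Oplus>\<^bsub>A\<^esub>i\<in>{..m + n}. p i \<otimes>\<^bsub>A\<^esub> ?Q)"
  proof (rule M.finsum_cong')
    fix i assume "i \<in> {..m + n}"
    have "(\<Oplus>\<^bsub>A\<^esub>j\<in>{..m + n - i}. p i \<otimes>\<^bsub>A\<^esub> q j) = p i \<otimes>\<^bsub>A\<^esub> (\<Oplus>\<^bsub>A\<^esub>j\<in>{..m + n - i}. q j)"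
      using p q by (simp add: finsum_mult)
    also have "\<dots> = p i \<otimes>\<^bsub>A\<^esub> ?Q"
    proof (cases "i \<le> m")
      case True
      then show ?thesis using M.finsum_extend[of n "m + n - i" q] q by simp
    next
      case False
      then show ?thesis using p q by simp
    qed
    finally show "(\<Oplus>\<^bsub>A\<^esub>j\<in>{..m + n - i}. p i \<otimes>\<^bsub>A\<^esub> q j) = p i \<otimes>\<^bsub>A\<^esub> ?Q" .
  qed (use p Q in auto)
  also have "\<dots> = (\<Oplus>\<^bsub>A\<^esub>i\<in>{..m + n}. p i) \<otimes>\<^bsub>A\<^esub> ?Q" using p Q by (simp add: finsum_mult)
  also have "(\<Oplus>\<^bsub>A\<^esub>i\<in>{..m + n}. p i) = (\<Oplus>\<^bsub>A\<^esub>i\<in>{..m}. p i)" using p by (intro M.finsum_extend) auto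
  finally show ?thesis .
qed

end


section \<open>The polynomial algebra\<close>

lemma poly_carrier:
  "p \<in> carrier (poly_alg B) \<longleftrightarrow>
    (\<forall>i. p i \<in> carrier B) \<and> (\<exists>n. \<forall>i>n. p i = \<zero>\<^bsub>B\<^esub>)"
  by (auto simp: poly_alg_def UP_def up_def bound_def)

lemma poly_carrierI:
  "\<lbrakk>\<And>i. p i \<in> carrier B; \<And>i. n < i \<Longrightarrow> p i = \<zero>\<^bsub>B\<^esub>\<rbrakk> \<Longrightarrow> p \<in> carrier (poly_alg B)"
  by (auto simp: poly_carrier)

lemma poly_coeff_closed: "p \<in> carrier (poly_alg B) \<Longrightarrow> p i \<in> carrier B"
  by (simp add: poly_carrier)

lemma poly_ops:
  shows "\<lbrakk>p \<in> carrier (poly_alg B); q \<in> carrier (poly_alg B)\<rbrakk> \<Longrightarrow>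
      p \<oplus>\<^bsub>poly_alg B\<^esub> q = (\<lambda>i. p i \<oplus>\<^bsub>B\<^esub> q i)"
    and "\<lbrakk>p \<in> carrier (poly_alg B); q \<in> carrier (poly_alg B)\<rbrakk> \<Longrightarrow>
      p \<otimes>\<^bsub>poly_alg B\<^esub> q = (\<lambda>n. \<Oplus>\<^bsub>B\<^esub>i\<in>{..n}. p i \<otimes>\<^bsub>B\<^esub> q (n - i))"
    and "h \<odot>\<^bsub>poly_alg B\<^esub> p = (\<lambda>i. h \<odot>\<^bsub>B\<^esub> p i)"
    and "p \<odot>\<^sub>r\<^bsub>poly_alg B\<^esub> h = (\<lambda>i. p i \<odot>\<^sub>r\<^bsub>B\<^esub> h)"
    and "\<zero>\<^bsub>poly_alg B\<^esub> = (\<lambda>i. \<zero>\<^bsub>B\<^esub>)"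
  by (simp_all add: poly_alg_def UP_def)

lemma poly_bound:
  assumes "p \<in> carrier (poly_alg B)"
  obtains n where "\<And>i. n < i \<Longrightarrow> p i = \<zero>\<^bsub>B\<^esub>"
  using assms by (auto simp: poly_carrier)

lemma poly_common_bound:
  assumes "p \<in> carrier (poly_alg B)" and "q \<in> carrier (poly_alg B)"
  obtains n where "\<And>i. n < i \<Longrightarrow> p i = \<zero>\<^bsub>B\<^esub>" and "\<And>i. n < i \<Longrightarrow> q i = \<zero>\<^bsub>B\<^esub>"
proof -
  obtain m n where "\<forall>i>m. p i = \<zero>\<^bsub>B\<^esub>" "\<forall>i>n. q i = \<zero>\<^bsub>B\<^esub>"
    using assms by (auto simp: poly_carrier)
  thus ?thesis using that[of "max m n"] by auto
qed

lemma (in h_algebra) convolution_zero: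
  assumes p: "\<And>i::nat. p i \<in> carrier A" "\<And>i. m < i \<Longrightarrow> p i = \<zero>\<^bsub>A\<^esub>"
    and q: "\<And>j::nat. q j \<in> carrier A" "\<And>j. n < j \<Longrightarrow> q j = \<zero>\<^bsub>A\<^esub>"
    and k: "m + n < k"
  shows "(\<Oplus>\<^bsub>A\<^esub>i\<in>{..k}. p i \<otimes>\<^bsub>A\<^esub> q (k - i)) = \<zero>\<^bsub>A\<^esub>"
proof -
  have "p i \<otimes>\<^bsub>A\<^esub> q (k - i) = \<zero>\<^bsub>A\<^esub>" for i
    using p q(1) q(2)[of "k - i"] k by (cases "i \<le> m") auto
  thus ?thesis by (simp cong: M.finsum_cong)
qed

lemma poly_closed:
  assumes B: "is_alg z H B"
  shows "\<lbrakk>p \<in> carrier (poly_alg B); q \<in> carrier (poly_alg B)\<rbrakk> \<Longrightarrow>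
      p \<oplus>\<^bsub>poly_alg B\<^esub> q \<in> carrier (poly_alg B)"
    and "\<lbrakk>p \<in> carrier (poly_alg B); q \<in> carrier (poly_alg B)\<rbrakk> \<Longrightarrow>
      p \<otimes>\<^bsub>poly_alg B\<^esub> q \<in> carrier (poly_alg B)"
    and "\<lbrakk>h \<in> carrier H; p \<in> carrier (poly_alg B)\<rbrakk> \<Longrightarrow> h \<odot>\<^bsub>poly_alg B\<^esub> p \<in> carrier (poly_alg B)"
    and "\<lbrakk>h \<in> carrier H; p \<in> carrier (poly_alg B)\<rbrakk> \<Longrightarrow> p \<odot>\<^sub>r\<^bsub>poly_alg B\<^esub> h \<in> carrier (poly_alg B)"
    and "\<zero>\<^bsub>poly_alg B\<^esub> \<in> carrier (poly_alg B)"
proof -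
  interpret B: h_algebra H B by (rule is_algD[OF B])
  note [simp] = poly_coeff_closed
  {
    assume pq: "p \<in> carrier (poly_alg B)" "q \<in> carrier (poly_alg B)"
    from pq obtain n where n: "\<And>i. n < i \<Longrightarrow> p i = \<zero>\<^bsub>B\<^esub>" "\<And>i. n < i \<Longrightarrow> q i = \<zero>\<^bsub>B\<^esub>"
      by (rule poly_common_bound) blast
    show "p \<oplus>\<^bsub>poly_alg B\<^esub> q \<in> carrier (poly_alg B)"
      using pq n by (intro poly_carrierI[of _ _ n]) (simp_all add: poly_ops)
    show "p \<otimes>\<^bsub>poly_alg B\<^esub> q \<in> carrier (poly_alg B)"
      using pq n B.convolution_zero[of p n q n]
      by (intro poly_carrierI[of _ _ "n + n"]) (simp_all add: poly_ops)
  next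
    assume h: "h \<in> carrier H" and p: "p \<in> carrier (poly_alg B)"
    obtain n where "\<And>i. n < i \<Longrightarrow> p i = \<zero>\<^bsub>B\<^esub>" by (rule poly_bound[OF p]) blast
    thus "h \<odot>\<^bsub>poly_alg B\<^esub> p \<in> carrier (poly_alg B)" "p \<odot>\<^sub>r\<^bsub>poly_alg B\<^esub> h \<in> carrier (poly_alg B)"
      using h p by (auto intro!: poly_carrierI[of _ _ n] simp: poly_ops)
  }
  show "\<zero>\<^bsub>poly_alg B\<^esub> \<in> carrier (poly_alg B)" by (simp add: poly_ops poly_carrier)
qed

lemma is_alg_poly:
  assumes B: "is_alg z H B"
  shows "is_alg z H (poly_alg B)"
proof -
  interpret B: h_algebra H B by (rule is_algD[OF B])
  note [simp] = poly_coeff_closed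
  note cl = poly_closed[OF B]
  have grp: "abelian_group (poly_alg B)"
  proof (rule abelian_groupI)
    fix p assume p: "p \<in> carrier (poly_alg B)"
    obtain n where "\<And>i. n < i \<Longrightarrow> p i = \<zero>\<^bsub>B\<^esub>" by (rule poly_bound[OF p]) blast
    hence "(\<lambda>i. \<ominus>\<^bsub>B\<^esub> p i) \<in> carrier (poly_alg B)"
      using p by (intro poly_carrierI[of _ _ n]) simp_all
    thus "\<exists>q\<in>carrier (poly_alg B). q \<oplus>\<^bsub>poly_alg B\<^esub> p = \<zero>\<^bsub>poly_alg B\<^esub>"
      using p by (intro bexI) (auto simp: poly_ops B.M.l_neg)
  next
    fix p q assume pq: "p \<in> carrier (poly_alg B)" "q \<in> carrier (poly_alg B)"
    show "p \<oplus>\<^bsub>poly_alg B\<^esub> q \<in> carrier (poly_alg B)" by (rule cl(1)[OF pq])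
    show "p \<oplus>\<^bsub>poly_alg B\<^esub> q = q \<oplus>\<^bsub>poly_alg B\<^esub> p" using pq by (simp add: poly_ops B.M.a_comm)
    fix r assume r: "r \<in> carrier (poly_alg B)"
    show "(p \<oplus>\<^bsub>poly_alg B\<^esub> q) \<oplus>\<^bsub>poly_alg B\<^esub> r = p \<oplus>\<^bsub>poly_alg B\<^esub> (q \<oplus>\<^bsub>poly_alg B\<^esub> r)"
      using pq r cl(1)[OF pq] cl(1)[OF pq(2) r] by (simp add: poly_ops B.M.a_assoc)
  next
    show "\<zero>\<^bsub>poly_alg B\<^esub> \<in> carrier (poly_alg B)" by (rule cl(5))
    show "\<zero>\<^bsub>poly_alg B\<^esub> \<oplus>\<^bsub>poly_alg B\<^esub> p = p" if "p \<in> carrier (poly_alg B)" for p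
      using that cl(5) by (simp add: poly_ops)
  qed
  have assoc: "(p \<otimes>\<^bsub>poly_alg B\<^esub> q) \<otimes>\<^bsub>poly_alg B\<^esub> r = p \<otimes>\<^bsub>poly_alg B\<^esub> (q \<otimes>\<^bsub>poly_alg B\<^esub> r)"
    if p: "p \<in> carrier (poly_alg B)" and q: "q \<in> carrier (poly_alg B)"
      and r: "r \<in> carrier (poly_alg B)" for p q r
  proof -
    have "((p \<otimes>\<^bsub>poly_alg B\<^esub> q) \<otimes>\<^bsub>poly_alg B\<^esub> r) n = (p \<otimes>\<^bsub>poly_alg B\<^esub> (q \<otimes>\<^bsub>poly_alg B\<^esub> r)) n" for n
    proof -
      have "((p \<otimes>\<^bsub>poly_alg B\<^esub> q) \<otimes>\<^bsub>poly_alg B\<^esub> r) n =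
          (\<Oplus>\<^bsub>B\<^esub>k\<in>{..n}. (\<Oplus>\<^bsub>B\<^esub>i\<in>{..k}. p i \<otimes>\<^bsub>B\<^esub> q (k - i)) \<otimes>\<^bsub>B\<^esub> r (n - k))"
        using p q r cl(2)[OF p q] by (simp add: poly_ops)
      \<comment> \<open>Rewriting \<open>n - k\<close> as \<open>n - i - (k - i)\<close> makes the summand a function of \<open>i\<close> and \<open>k - i\<close>.\<close>
      also have "\<dots> = (\<Oplus>\<^bsub>B\<^esub>k\<in>{..n}. \<Oplus>\<^bsub>B\<^esub>i\<in>{..k}. (p i \<otimes>\<^bsub>B\<^esub> q (k - i)) \<otimes>\<^bsub>B\<^esub> r (n - i - (k - i)))"
        using p q r by (auto intro!: B.M.finsum_cong' simp: B.finsum_mult)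
      also have "\<dots> = (\<Oplus>\<^bsub>B\<^esub>i\<in>{..n}. \<Oplus>\<^bsub>B\<^esub>j\<in>{..n - i}. (p i \<otimes>\<^bsub>B\<^esub> q j) \<otimes>\<^bsub>B\<^esub> r (n - i - j))"
        by (rule B.M.finsum_triangle) (use p q r in simp)
      also have "\<dots> = (\<Oplus>\<^bsub>B\<^esub>i\<in>{..n}. p i \<otimes>\<^bsub>B\<^esub> (\<Oplus>\<^bsub>B\<^esub>j\<in>{..n - i}. q j \<otimes>\<^bsub>B\<^esub> r (n - i - j)))"
        using p q r by (auto intro!: B.M.finsum_cong' simp: B.finsum_mult B.mult_assoc)
      also have "\<dots> = (p \<otimes>\<^bsub>poly_alg B\<^esub> (q \<otimes>\<^bsub>poly_alg B\<^esub> r)) n"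
        using p q r cl(2)[OF q r] by (simp add: poly_ops)
      finally show ?thesis .
    qed
    thus ?thesis by blast
  qed
  have ldistr: "(p \<oplus>\<^bsub>poly_alg B\<^esub> q) \<otimes>\<^bsub>poly_alg B\<^esub> r = p \<otimes>\<^bsub>poly_alg B\<^esub> r \<oplus>\<^bsub>poly_alg B\<^esub> q \<otimes>\<^bsub>poly_alg B\<^esub> r"
    and rdistr: "r \<otimes>\<^bsub>poly_alg B\<^esub> (p \<oplus>\<^bsub>poly_alg B\<^esub> q) = r \<otimes>\<^bsub>poly_alg B\<^esub> p \<oplus>\<^bsub>poly_alg B\<^esub> r \<otimes>\<^bsub>poly_alg B\<^esub> q"
    if p: "p \<in> carrier (poly_alg B)" and q: "q \<in> carrier (poly_alg B)"
      and r: "r \<in> carrier (poly_alg B)" for p q r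
    using p q r cl(1)[OF p q] cl(2)[OF p r] cl(2)[OF q r] cl(2)[OF r p] cl(2)[OF r q]
    by (simp_all add: poly_ops B.mult_l_distr B.mult_r_distr B.M.finsum_addf)
  have mult_scal:
    "(h \<odot>\<^bsub>poly_alg B\<^esub> p) \<otimes>\<^bsub>poly_alg B\<^esub> q = h \<odot>\<^bsub>poly_alg B\<^esub> (p \<otimes>\<^bsub>poly_alg B\<^esub> q)"
    "p \<otimes>\<^bsub>poly_alg B\<^esub> (q \<odot>\<^sub>r\<^bsub>poly_alg B\<^esub> h) = (p \<otimes>\<^bsub>poly_alg B\<^esub> q) \<odot>\<^sub>r\<^bsub>poly_alg B\<^esub> h"
    "(p \<odot>\<^sub>r\<^bsub>poly_alg B\<^esub> h) \<otimes>\<^bsub>poly_alg B\<^esub> q = p \<otimes>\<^bsub>poly_alg B\<^esub> (h \<odot>\<^bsub>poly_alg B\<^esub> q)"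
    if h: "h \<in> carrier H" and p: "p \<in> carrier (poly_alg B)" and q: "q \<in> carrier (poly_alg B)"
    for h p q
    using h p q cl(3)[OF h p] cl(3)[OF h q] cl(4)[OF h p] cl(4)[OF h q]
    by (simp_all add: poly_ops B.finsum_scal B.mult_l B.mult_r B.mult_balanced)
  note add = poly_ops(1)[OF cl(3) cl(3), unfolded poly_ops]
    poly_ops(1)[OF cl(4) cl(4), unfolded poly_ops]
  have "h_algebra H (poly_alg B)"
    by (intro h_algebra.intro bimodule.intro bimodule_axioms.intro h_algebra_axioms.intro
        B.H.ring_axioms grp assoc ldistr rdistr mult_scal cl)
      (simp_all add: add poly_ops B.l_add_scal B.l_add B.l_assoc B.l_unit
        B.r_add_scal B.r_add B.r_assoc B.r_unit B.lr_assoc)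
  moreover have "z \<longrightarrow> central H (poly_alg B)"
    using B by (auto simp: is_alg_def central_def poly_ops)
  ultimately show ?thesis by (simp add: is_alg_def)
qed

lemma poly_map_hom:
  assumes A: "is_alg z H A" and B: "is_alg z H B" and f: "f \<in> alg_hom H A B"
  shows "(\<lambda>p i. f (p i)) \<in> alg_hom H (poly_alg A) (poly_alg B)"
proof -
  interpret A: h_algebra H A by (rule is_algD[OF A])
  interpret B: h_algebra H B by (rule is_algD[OF B])
  note gA = A.M.abelian_group_axioms and gB = B.M.abelian_group_axioms
  note [simp] = poly_coeff_closed alg_hom_closed[OF f] alg_homD[OF f]
  have cl: "(\<lambda>i. f (p i)) \<in> carrier (poly_alg B)" if p: "p \<in> carrier (poly_alg A)" for p
  proof -
    obtain n where "\<And>i. n < i \<Longrightarrow> p i = \<zero>\<^bsub>A\<^esub>" by (rule poly_bound[OF p]) blast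
    thus ?thesis using p alg_hom_zero[OF gA gB f] by (intro poly_carrierI[of _ _ n]) simp_all
  qed
  show ?thesis
  proof (rule alg_homI)
    fix p q assume pq: "p \<in> carrier (poly_alg A)" "q \<in> carrier (poly_alg A)"
    have "f (\<Oplus>\<^bsub>A\<^esub>i\<in>{..n}. p i \<otimes>\<^bsub>A\<^esub> q (n - i)) = (\<Oplus>\<^bsub>B\<^esub>i\<in>{..n}. f (p i) \<otimes>\<^bsub>B\<^esub> f (q (n - i)))" for n
      using pq additive_finsum[OF gA gB alg_hom_closed[OF f] alg_homD(1)[OF f],
          of "\<lambda>i. p i \<otimes>\<^bsub>A\<^esub> q (n - i)" "{..n}"] by simp
    thus "(\<lambda>i. f ((p \<otimes>\<^bsub>poly_alg A\<^esub> q) i)) = (\<lambda>i. f (p i)) \<otimes>\<^bsub>poly_alg B\<^esub> (\<lambda>i. f (q i))"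
      using pq cl by (simp add: poly_ops)
  qed (simp_all add: cl poly_ops)
qed

text \<open>
  The functor \<open>(-)[t]\<close> preserves kernels, because the kernel of a coefficientwise map is computed
  coefficientwise. The inverse image of a polynomial has finite support since \<open>f\<close> is injective and
  sends \<open>0\<close> to \<open>0\<close>.
\<close>

lemma poly_map_ker:
  assumes A: "is_alg z H A" and B: "is_alg z H B" and f: "f \<in> alg_hom H A B"
    and ker: "is_ker A f B g C"
  shows "is_ker (poly_alg A) (\<lambda>p i. f (p i)) (poly_alg B) (\<lambda>p i. g (p i)) (poly_alg C)"
proof -
  have f0: "f \<zero>\<^bsub>A\<^esub> = \<zero>\<^bsub>B\<^esub>" by (rule alg_hom_zero[OF is_alg_group[OF A] is_alg_group[OF B] f])
  interpret A: abelian_group A by (rule is_alg_group[OF A])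
  have inj: "inj_on f (carrier A)" and im: "f ` carrier A = a_kernel B C g"
    using ker by (auto simp: is_ker_def bij_betw_def)
  have "inj_on (\<lambda>p i. f (p i)) (carrier (poly_alg A))"
    by (rule inj_onI) (auto simp: fun_eq_iff poly_coeff_closed dest!: inj_onD[OF inj])
  moreover have "(\<lambda>i. f (p i)) \<in> a_kernel (poly_alg B) (poly_alg C) (\<lambda>p i. g (p i))"
    if p: "p \<in> carrier (poly_alg A)" for p
  proof -
    have "f (p i) \<in> a_kernel B C g" for i using im poly_coeff_closed[OF p] by blast
    thus ?thesis
      using alg_hom_closed[OF poly_map_hom[OF A B f] p] by (auto simp: a_kernel_def' poly_ops)
  qed
  moreover have "q \<in> (\<lambda>p i. f (p i)) ` carrier (poly_alg A)"
    if q: "q \<in> a_kernel (poly_alg B) (poly_alg C) (\<lambda>p i. g (p i))" for q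
  proof -
    have qB: "q \<in> carrier (poly_alg B)" using q by (simp add: a_kernel_def')
    have "q i \<in> f ` carrier A" for i
      using q poly_coeff_closed[OF qB, of i]
      by (auto simp: im a_kernel_def' poly_ops fun_eq_iff)
    hence e: "the_inv_into (carrier A) f (q i) \<in> carrier A"
      "f (the_inv_into (carrier A) f (q i)) = q i" for i
      using the_inv_into_into[OF inj _ order_refl] f_the_inv_into_f[OF inj] by auto
    obtain n where n: "\<And>i. n < i \<Longrightarrow> q i = \<zero>\<^bsub>B\<^esub>" by (rule poly_bound[OF qB]) blast
    have "the_inv_into (carrier A) f (q i) = \<zero>\<^bsub>A\<^esub>" if "n < i" for i
      using the_inv_into_f_f[OF inj A.zero_closed] n[OF that] f0 by simp
    hence "(\<lambda>i. the_inv_into (carrier A) f (q i)) \<in> carrier (poly_alg A)"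
      using e by (intro poly_carrierI[of _ _ n])
    thus ?thesis using e by (intro image_eqI[of _ _ "\<lambda>i. the_inv_into (carrier A) f (q i)"]) auto
  qed
  ultimately show ?thesis by (auto simp: is_ker_def bij_betw_def)
qed


section \<open>Evaluation of polynomials\<close>

text \<open>
  Evaluation may be computed with any bound on the support, so that two polynomials and their sum or
  product can be compared without knowing their degrees.
\<close>

lemma poly_ev_bound:
  assumes B: "is_alg z H B" and p: "p \<in> carrier (poly_alg B)" and n: "\<And>i. n < i \<Longrightarrow> p i = \<zero>\<^bsub>B\<^esub>"
  shows "poly_ev B k p = (\<Oplus>\<^bsub>B\<^esub>i\<in>{..n}. [(k ^ i)] \<cdot>\<^bsub>B\<^esub> p i)"
proof -
  interpret B: abelian_group B by (rule is_alg_group[OF B])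
  have deg: "deg B p = (LEAST n. bound \<zero>\<^bsub>B\<^esub> n p)"
    using p by (simp add: deg_def UP_def poly_alg_def)
  have b: "bound \<zero>\<^bsub>B\<^esub> n p" using n by auto
  have le: "deg B p \<le> n" unfolding deg by (rule Least_le) (rule b)
  have "bound \<zero>\<^bsub>B\<^esub> (deg B p) p" unfolding deg by (rule LeastI) (rule b)
  hence "p i = \<zero>\<^bsub>B\<^esub>" if "deg B p < i" for i using that by auto
  thus ?thesis unfolding poly_ev_def
    by (intro B.finsum_extend[OF le, symmetric]) (simp_all add: poly_coeff_closed[OF p] B.add.nat_pow_one)
qed

text \<open>
  Since \<open>k\<^sup>i\<^sup>+\<^sup>j (p\<^sub>i q\<^sub>j) = (k\<^sup>i p\<^sub>i) (k\<^sup>j q\<^sub>j)\<close>, evaluation at \<open>k\<close> is multiplicative by the Cauchy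
  product formula for the rescaled families \<open>k\<^sup>i p\<^sub>i\<close> and \<open>k\<^sup>j q\<^sub>j\<close>.
\<close>

lemma poly_ev_hom:
  assumes B: "is_alg z H B"
  shows "poly_ev B k \<in> alg_hom H (poly_alg B) B"
proof -
  interpret B: h_algebra H B by (rule is_algD[OF B])
  note gB = B.M.abelian_group_axioms
  note [simp] = poly_coeff_closed
  note cl = poly_closed[OF B]
  show ?thesis
  proof (rule alg_homI)
    fix p assume p: "p \<in> carrier (poly_alg B)"
    obtain n where n: "\<And>i. n < i \<Longrightarrow> p i = \<zero>\<^bsub>B\<^esub>" by (rule poly_bound[OF p]) blast
    show "poly_ev B k p \<in> carrier B" using p by (simp add: poly_ev_bound[OF B p n])
    fix h assume h: "h \<in> carrier H"
    have ls: "([m] \<cdot>\<^bsub>B\<^esub> (h \<odot>\<^bsub>B\<^esub> p i)) = h \<odot>\<^bsub>B\<^esub> ([m] \<cdot>\<^bsub>B\<^esub> p i)" for m :: nat and i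
      using h p by (intro additive_add_pow[OF gB gB, symmetric]) (auto simp: B.l_add)
    have rs: "([m] \<cdot>\<^bsub>B\<^esub> (p i \<odot>\<^sub>r\<^bsub>B\<^esub> h)) = ([m] \<cdot>\<^bsub>B\<^esub> p i) \<odot>\<^sub>r\<^bsub>B\<^esub> h" for m :: nat and i
      using h p by (intro additive_add_pow[OF gB gB, symmetric]) (auto simp: B.r_add)
    show "poly_ev B k (h \<odot>\<^bsub>poly_alg B\<^esub> p) = h \<odot>\<^bsub>B\<^esub> poly_ev B k p"
      using h p n
      by (subst poly_ev_bound[OF B cl(3)[OF h p], of n])
        (simp_all add: poly_ev_bound[OF B p n] poly_ops B.finsum_scal ls)
    show "poly_ev B k (p \<odot>\<^sub>r\<^bsub>poly_alg B\<^esub> h) = poly_ev B k p \<odot>\<^sub>r\<^bsub>B\<^esub> h"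
      using h p n
      by (subst poly_ev_bound[OF B cl(4)[OF h p], of n])
        (simp_all add: poly_ev_bound[OF B p n] poly_ops B.finsum_scal rs)
  next
    fix p q assume p: "p \<in> carrier (poly_alg B)" and q: "q \<in> carrier (poly_alg B)"
    obtain n where n: "\<And>i. n < i \<Longrightarrow> p i = \<zero>\<^bsub>B\<^esub>" "\<And>i. n < i \<Longrightarrow> q i = \<zero>\<^bsub>B\<^esub>"
      by (rule poly_common_bound[OF p q]) blast
    note ev = poly_ev_bound[OF B p n(1)] poly_ev_bound[OF B q n(2)]
    have "poly_ev B k (p \<oplus>\<^bsub>poly_alg B\<^esub> q) = (\<Oplus>\<^bsub>B\<^esub>i\<in>{..n}. [(k ^ i)] \<cdot>\<^bsub>B\<^esub> (p i \<oplus>\<^bsub>B\<^esub> q i))"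
      using p q n by (subst poly_ev_bound[OF B cl(1)[OF p q], of n]) (simp_all add: poly_ops)
    also have "\<dots> = poly_ev B k p \<oplus>\<^bsub>B\<^esub> poly_ev B k q"
      using p q by (simp add: ev B.M.add.nat_pow_distrib B.M.finsum_addf B.M.a_comm)
    finally show "poly_ev B k (p \<oplus>\<^bsub>poly_alg B\<^esub> q) = poly_ev B k p \<oplus>\<^bsub>B\<^esub> poly_ev B k q" .
    have pow: "([(k ^ j)] \<cdot>\<^bsub>B\<^esub> (\<Oplus>\<^bsub>B\<^esub>i\<in>{..j}. p i \<otimes>\<^bsub>B\<^esub> q (j - i))) =
        (\<Oplus>\<^bsub>B\<^esub>i\<in>{..j}. ([(k ^ i)] \<cdot>\<^bsub>B\<^esub> p i) \<otimes>\<^bsub>B\<^esub> ([(k ^ (j - i))] \<cdot>\<^bsub>B\<^esub> q (j - i)))" for j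
    proof -
      have "([(k ^ j)] \<cdot>\<^bsub>B\<^esub> (\<Oplus>\<^bsub>B\<^esub>i\<in>{..j}. p i \<otimes>\<^bsub>B\<^esub> q (j - i))) =
          (\<Oplus>\<^bsub>B\<^esub>i\<in>{..j}. [(k ^ j)] \<cdot>\<^bsub>B\<^esub> (p i \<otimes>\<^bsub>B\<^esub> q (j - i)))"
        using p q by (intro additive_finsum[OF gB gB]) (auto simp: B.M.add.nat_pow_distrib B.M.a_comm)
      also have "\<dots> = (\<Oplus>\<^bsub>B\<^esub>i\<in>{..j}. ([(k ^ i)] \<cdot>\<^bsub>B\<^esub> p i) \<otimes>\<^bsub>B\<^esub> ([(k ^ (j - i))] \<cdot>\<^bsub>B\<^esub> q (j - i)))"
        using p q by (intro B.M.finsum_cong') (auto simp: B.add_pow_mult power_add[symmetric])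
      finally show ?thesis .
    qed
    show "poly_ev B k (p \<otimes>\<^bsub>poly_alg B\<^esub> q) = poly_ev B k p \<otimes>\<^bsub>B\<^esub> poly_ev B k q"
      using p q n B.convolution_zero[of p n q n]
        B.cauchy_product[of "\<lambda>i. [(k ^ i)] \<cdot>\<^bsub>B\<^esub> p i" n "\<lambda>i. [(k ^ i)] \<cdot>\<^bsub>B\<^esub> q i" n]
      by (subst poly_ev_bound[OF B cl(2)[OF p q], of "n + n"]) (simp_all add: poly_ops pow ev B.M.add.nat_pow_one)
  qed
qed

lemma poly_ev_map:
  assumes A: "is_alg z H A" and B: "is_alg z H B" and f: "f \<in> alg_hom H A B"
    and p: "p \<in> carrier (poly_alg A)"
  shows "poly_ev B k (\<lambda>i. f (p i)) = f (poly_ev A k p)"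
proof -
  interpret A: abelian_group A by (rule is_alg_group[OF A])
  note gA = is_alg_group[OF A] and gB = is_alg_group[OF B]
  note cl = alg_hom_closed[OF f] and add = alg_homD(1)[OF f]
  obtain n where n: "\<And>i. n < i \<Longrightarrow> p i = \<zero>\<^bsub>A\<^esub>" by (rule poly_bound[OF p]) blast
  have fn: "f (p i) = \<zero>\<^bsub>B\<^esub>" if "n < i" for i using n[OF that] alg_hom_zero[OF gA gB f] by simp
  have "f (poly_ev A k p) = (\<Oplus>\<^bsub>B\<^esub>i\<in>{..n}. f ([(k ^ i)] \<cdot>\<^bsub>A\<^esub> p i))"
    using poly_coeff_closed[OF p]
    by (simp add: poly_ev_bound[OF A p n] additive_finsum[OF gA gB cl add])
  also have "\<dots> = poly_ev B k (\<lambda>i. f (p i))"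
    using poly_coeff_closed[OF p] alg_hom_closed[OF poly_map_hom[OF A B f] p]
    by (simp add: poly_ev_bound[OF B _ fn] additive_add_pow[OF gA gB cl add])
  finally show ?thesis ..
qed


section \<open>Straight-line homotopies\<close>

text \<open>The polynomial \<open>(1 - t) x + t y\<close>; for \<open>x = y\<close> it is the constant \<open>x\<close>.\<close>

definition poly_line :: "('h, 'b) bimod \<Rightarrow> 'b \<Rightarrow> 'b \<Rightarrow> nat \<Rightarrow> 'b" where
  "poly_line B x y = (\<lambda>i. if i = 0 then x else if i = 1 then y \<ominus>\<^bsub>B\<^esub> x else \<zero>\<^bsub>B\<^esub>)"

lemma poly_line_closed:
  assumes B: "is_alg z H B" and "x \<in> carrier B" and "y \<in> carrier B"
  shows "poly_line B x y \<in> carrier (poly_alg B)"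
proof -
  interpret B: abelian_group B by (rule is_alg_group[OF B])
  show ?thesis
    by (rule poly_carrierI[of _ _ 1]) (use assms in \<open>auto simp: poly_line_def\<close>)
qed

lemma poly_ev_line:
  assumes B: "is_alg z H B" and xy: "x \<in> carrier B" "y \<in> carrier B"
  shows "poly_ev B 0 (poly_line B x y) = x" and "poly_ev B 1 (poly_line B x y) = y"
proof -
  interpret B: abelian_group B by (rule is_alg_group[OF B])
  have "poly_ev B k (poly_line B x y) = (\<Oplus>\<^bsub>B\<^esub>i\<in>{..1}. [(k ^ i)] \<cdot>\<^bsub>B\<^esub> poly_line B x y i)" for k
    by (rule poly_ev_bound[OF B poly_line_closed[OF B xy]]) (simp add: poly_line_def)
  also have "(\<Oplus>\<^bsub>B\<^esub>i\<in>{..1}. [(k ^ i)] \<cdot>\<^bsub>B\<^esub> poly_line B x y i) =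
      ([k] \<cdot>\<^bsub>B\<^esub> (y \<ominus>\<^bsub>B\<^esub> x)) \<oplus>\<^bsub>B\<^esub> x" for k :: nat
    using xy by (simp add: poly_line_def)
  finally have ev: "poly_ev B k (poly_line B x y) = ([k] \<cdot>\<^bsub>B\<^esub> (y \<ominus>\<^bsub>B\<^esub> x)) \<oplus>\<^bsub>B\<^esub> x" for k .
  show "poly_ev B 0 (poly_line B x y) = x" "poly_ev B 1 (poly_line B x y) = y"
    unfolding ev using xy by (simp_all add: a_minus_def B.a_assoc B.l_neg)
qed

lemma poly_line_add:
  assumes B: "is_alg z H B"
    and "x \<in> carrier B" "y \<in> carrier B" "x' \<in> carrier B" "y' \<in> carrier B"
  shows "poly_line B (x \<oplus>\<^bsub>B\<^esub> x') (y \<oplus>\<^bsub>B\<^esub> y') =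
    poly_line B x y \<oplus>\<^bsub>poly_alg B\<^esub> poly_line B x' y'"
proof -
  interpret B: abelian_group B by (rule is_alg_group[OF B])
  show ?thesis
    using assms by (auto simp: poly_ops poly_line_closed[OF B])
      (auto simp: poly_line_def fun_eq_iff a_minus_def B.minus_add B.a_ac)
qed

text \<open>
  The segment from \<open>x\<close> to \<open>y\<close> is natural for additive maps. Besides algebra homomorphisms this covers
  the actions of the elements of \<open>H\<close>.
\<close>

lemma additive_poly_line:
  assumes B: "is_alg z H B" and D: "is_alg z H D"
    and f: "\<And>x. x \<in> carrier B \<Longrightarrow> f x \<in> carrier D"
      "\<And>x y. \<lbrakk>x \<in> carrier B; y \<in> carrier B\<rbrakk> \<Longrightarrow> f (x \<oplus>\<^bsub>B\<^esub> y) = f x \<oplus>\<^bsub>D\<^esub> f y"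
    and xy: "x \<in> carrier B" "y \<in> carrier B"
  shows "(\<lambda>i. f (poly_line B x y i)) = poly_line D (f x) (f y)"
proof -
  interpret B: abelian_group B by (rule is_alg_group[OF B])
  interpret D: abelian_group D by (rule is_alg_group[OF D])
  have zero: "f \<zero>\<^bsub>B\<^esub> = \<zero>\<^bsub>D\<^esub>"
    using additive_finsum[OF B.abelian_group_axioms D.abelian_group_axioms f, of "\<lambda>x. x" "{}"] by simp
  have "f (y \<oplus>\<^bsub>B\<^esub> \<ominus>\<^bsub>B\<^esub> x) \<oplus>\<^bsub>D\<^esub> f x = f y"
    using f(2)[of "y \<oplus>\<^bsub>B\<^esub> \<ominus>\<^bsub>B\<^esub> x" x] xy by (simp add: B.a_assoc B.l_neg)
  hence "f (y \<ominus>\<^bsub>B\<^esub> x) = f y \<ominus>\<^bsub>D\<^esub> f x"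
    using f(1) xy D.add.inv_solve_right[of "f (y \<oplus>\<^bsub>B\<^esub> \<ominus>\<^bsub>B\<^esub> x)" "f y" "f x"] by (simp add: a_minus_def)
  thus ?thesis using zero by (auto simp: poly_line_def)
qed

text \<open>
  The segment between two morphisms of the underlying category is again one, whichever of the three
  categories it is: \<open>x\<close> and \<open>y\<close> enter \<open>(1 - t) x + t y\<close> additively and \<open>H\<close>-linearly.
\<close>

lemma poly_line_under_hom:
  assumes B: "is_alg z H B" and s: "s \<in> under_hom u H X B" "s' \<in> under_hom u H X B"
  shows "(\<lambda>x. poly_line B (s x) (s' x)) \<in> under_hom u H X (poly_alg B)"
proof -
  interpret B: h_algebra H B by (rule is_algD[OF B])
  have cl: "s x \<in> carrier B" "s' x \<in> carrier B" if "x \<in> carrier X" for x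
    using s that by (auto simp: under_hom_def)
  have scal: "poly_line B (h \<odot>\<^bsub>B\<^esub> x) (h \<odot>\<^bsub>B\<^esub> y) = h \<odot>\<^bsub>poly_alg B\<^esub> poly_line B x y"
    "poly_line B (x \<odot>\<^sub>r\<^bsub>B\<^esub> h) (y \<odot>\<^sub>r\<^bsub>B\<^esub> h) = poly_line B x y \<odot>\<^sub>r\<^bsub>poly_alg B\<^esub> h"
    if "h \<in> carrier H" "x \<in> carrier B" "y \<in> carrier B" for h x y
    using that additive_poly_line[OF B B, of "\<lambda>x. h \<odot>\<^bsub>B\<^esub> x" x y]
      additive_poly_line[OF B B, of "\<lambda>x. x \<odot>\<^sub>r\<^bsub>B\<^esub> h" x y]
    by (simp_all add: poly_ops B.l_add B.r_add)
  show ?thesis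
    using s cl unfolding under_hom_def
    by (auto simp: poly_line_closed[OF B] poly_line_add[OF B] scal)
qed

lemma poly_line_const_hom:
  assumes B: "is_alg z H B"
  shows "(\<lambda>x. poly_line B x x) \<in> alg_hom H B (poly_alg B)"
proof -
  interpret B: h_algebra H B by (rule is_algD[OF B])
  note cl = poly_line_closed[OF B]
  have c: "poly_line B x x = (\<lambda>i. if i = 0 then x else \<zero>\<^bsub>B\<^esub>)" if "x \<in> carrier B" for x
    using that by (auto simp: poly_line_def a_minus_def B.M.r_neg)
  show ?thesis
  proof (rule alg_homI)
    fix x y assume xy: "x \<in> carrier B" "y \<in> carrier B"
    have "(\<Oplus>\<^bsub>B\<^esub>i\<in>{..n}. (if i = 0 then x else \<zero>\<^bsub>B\<^esub>) \<otimes>\<^bsub>B\<^esub> (if n - i = 0 then y else \<zero>\<^bsub>B\<^esub>)) =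
        (if n = 0 then x \<otimes>\<^bsub>B\<^esub> y else \<zero>\<^bsub>B\<^esub>)" for n :: nat
    proof -
      have "(\<Oplus>\<^bsub>B\<^esub>i\<in>{..n}. (if i = 0 then x else \<zero>\<^bsub>B\<^esub>) \<otimes>\<^bsub>B\<^esub> (if n - i = 0 then y else \<zero>\<^bsub>B\<^esub>)) =
          (\<Oplus>\<^bsub>B\<^esub>i\<in>{..n}. if i = 0 then (if n = 0 then x \<otimes>\<^bsub>B\<^esub> y else \<zero>\<^bsub>B\<^esub>) else \<zero>\<^bsub>B\<^esub>)"
        by (rule B.M.finsum_cong') (use xy in auto)
      also have "\<dots> = (if n = 0 then x \<otimes>\<^bsub>B\<^esub> y else \<zero>\<^bsub>B\<^esub>)"
        using xy by (intro B.M.add.finprod_singleton_swap) auto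
      finally show ?thesis .
    qed
    thus "poly_line B (x \<otimes>\<^bsub>B\<^esub> y) (x \<otimes>\<^bsub>B\<^esub> y) =
        poly_line B x x \<otimes>\<^bsub>poly_alg B\<^esub> poly_line B y y"
      using xy cl[OF xy(1,1)] cl[OF xy(2,2)] by (simp add: poly_ops c)
  qed (auto simp: cl poly_line_add[OF B], auto simp: c poly_ops)
qed

lemma free_unit_comp_under_hom:
  assumes H: "ring H" and X: "is_under u z H X" and \<phi>: "\<phi> \<in> alg_hom H (free_alg u z H X) B"
  shows "(\<lambda>x. \<phi> (free_unit u z H X x)) \<in> under_hom u H X B"
  using free_unit_hom[OF H X] alg_hom_under_hom[OF \<phi>]
  by (auto simp: under_hom_def Pi_iff)

text \<open>
  The uniqueness half of the adjunction, in the form in which all identities between homomorphisms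
  out of \<open>T\<close> are obtained: it is enough to compare them on generators.
\<close>

lemma free_alg_hom_eqI:
  assumes H: "ring H" and X: "is_under u z H X" and B: "is_alg z H B"
    and hom: "\<phi> \<in> alg_hom H (free_alg u z H X) B" "\<psi> \<in> alg_hom H (free_alg u z H X) B"
    and eq: "\<And>x. x \<in> carrier X \<Longrightarrow> \<phi> (free_unit u z H X x) = \<psi> (free_unit u z H X x)"
    and a: "a \<in> carrier (free_alg u z H X)"
  shows "\<phi> a = \<psi> a"
proof -
  note s = free_unit_comp_under_hom[OF H X hom(2)]
  show ?thesis
    using free_alg_universal(3)[OF H B s hom(1) eq a] free_alg_universal(3)[OF H B s hom(2) _ a]
    by simp
qed

text \<open>
  Any two homomorphisms out of a free algebra are elementary homotopic, and over a homomorphism \<open>g\<close>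
  that does not distinguish them the homotopy can be chosen constant: it is the extension of the segment
  between their restrictions to the generators.
\<close>

lemma free_alg_homotopy:
  fixes X :: "('h, 'x) bimod" and B :: "('h, 'b) bimod" and C :: "('h, 'c) bimod"
  assumes H: "ring H" and X: "is_under u z H X" and B: "is_alg z H B" and C: "is_alg z H C"
    and hom: "\<phi> \<in> alg_hom H (free_alg u z H X) B" "\<psi> \<in> alg_hom H (free_alg u z H X) B"
    and g: "g \<in> alg_hom H B C"
    and over: "\<And>a. a \<in> carrier (free_alg u z H X) \<Longrightarrow> g (\<phi> a) = g (\<psi> a)"
  shows "\<exists>\<Phi> \<in> alg_hom H (free_alg u z H X) (poly_alg B). \<forall>a\<in>carrier (free_alg u z H X).
    poly_ev B 0 (\<Phi> a) = \<phi> a \<and> poly_ev B 1 (\<Phi> a) = \<psi> a \<and>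
    (\<lambda>i. g (\<Phi> a i)) = poly_line C (g (\<phi> a)) (g (\<phi> a))"
proof -
  let ?T = "free_alg u z H X" and ?e = "free_unit u z H X"
  have e: "?e x \<in> carrier ?T" if "x \<in> carrier X" for x
    using that free_unit_hom[OF H X] by (auto simp: under_hom_def)
  note s = free_unit_comp_under_hom[OF H X]
  note P = is_alg_poly[OF B]
  note line = poly_line_under_hom[OF B s[OF hom(1)] s[OF hom(2)]]
  define \<Phi> where "\<Phi> = free_lift (poly_alg B) (\<lambda>x. poly_line B (\<phi> (?e x)) (\<psi> (?e x)))"
  have \<Phi>: "\<Phi> \<in> alg_hom H ?T (poly_alg B)"
    and \<Phi>e: "\<And>x. x \<in> carrier X \<Longrightarrow> \<Phi> (?e x) = poly_line B (\<phi> (?e x)) (\<psi> (?e x))"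
    unfolding \<Phi>_def by (rule free_alg_universal(1,2)[OF H P line])+
  note cl = alg_hom_closed[OF hom(1) e] alg_hom_closed[OF hom(2) e]
  show ?thesis
  proof (intro bexI[OF _ \<Phi>] ballI conjI)
    fix a assume a: "a \<in> carrier ?T"
    show "poly_ev B 0 (\<Phi> a) = \<phi> a"
      by (rule free_alg_hom_eqI[OF H X B alg_hom_comp[OF \<Phi> poly_ev_hom[OF B]] hom(1) _ a])
        (simp add: \<Phi>e poly_ev_line[OF B] cl)
    show "poly_ev B 1 (\<Phi> a) = \<psi> a"
      by (rule free_alg_hom_eqI[OF H X B alg_hom_comp[OF \<Phi> poly_ev_hom[OF B]] hom(2) _ a])
        (simp only: \<Phi>e poly_ev_line[OF B] cl)
    show "(\<lambda>i. g (\<Phi> a i)) = poly_line C (g (\<phi> a)) (g (\<phi> a))"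
      by (rule free_alg_hom_eqI[OF H X is_alg_poly[OF C]
            alg_hom_comp[OF \<Phi> poly_map_hom[OF B C g]]
            alg_hom_comp[OF alg_hom_comp[OF hom(1) g] poly_line_const_hom[OF C]] _ a])
        (simp add: \<Phi>e cl e over additive_poly_line[OF B C alg_hom_closed[OF g] alg_homD(1)[OF g]])
  qed
qed


section \<open>The universal extension\<close>

lemma J_alg_ideal:
  assumes "ring H" and "is_alg z H C"
  shows "alg_ideal H (T_alg u z H C) (a_kernel (T_alg u z H C) C (counit C))"
  by (rule alg_ideal_ker[OF _ assms(2) counit_hom(1)[OF assms]])
    (simp add: T_alg_def is_alg_free_alg[OF assms(1)])

lemma J_extension:
  assumes H: "ring H" and C: "is_alg z H C"
  shows "extension z H (J_alg u z H C) J_incl (T_alg u z H C) (counit C) C"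
proof -
  let ?T = "T_alg u z H C" and ?K = "a_kernel (T_alg u z H C) C (counit C)"
  have T: "is_alg z H ?T" by (simp add: T_alg_def is_alg_free_alg[OF H])
  have \<eta>: "counit C \<in> alg_hom H ?T C" by (rule counit_hom(1)[OF H C])
  have K: "alg_ideal H ?T ?K" by (rule J_alg_ideal[OF H C])
  have J: "is_alg z H (J_alg u z H C)" unfolding J_alg_def by (rule is_alg_sub[OF T K])
  have incl: "J_incl \<in> alg_hom H (J_alg u z H C) ?T"
    by (rule alg_homI) (auto simp: J_alg_def J_incl_def a_kernel_def')
  have ker: "is_ker (J_alg u z H C) J_incl ?T (counit C) C"
    by (simp add: is_ker_def J_alg_def J_incl_def bij_betw_def)
  have "c \<in> counit C ` carrier ?T" if "c \<in> carrier C" for c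
    using that counit_hom(2)[OF H C that, of u] free_unit_hom[OF H is_alg_under[OF C], of u]
    by (intro image_eqI[of _ _ "free_unit u z H C c"]) (auto simp: T_alg_def under_hom_def)
  hence "counit C ` carrier ?T = carrier C" using alg_hom_closed[OF \<eta>] by auto
  moreover have "ideal_gen H ?T ?K = ?K"
    using K by (auto simp: ideal_gen_def)
  ultimately have "is_coker H (J_alg u z H C) J_incl ?T (counit C) C"
    by (simp add: is_coker_def J_alg_def J_incl_def)
  thus ?thesis using J T C incl \<eta> ker by (simp add: extension_def)
qed

lemma seq_hom_from_J_ex:
  assumes H: "ring H" and ext: "extension z H A f B g C" and split: "F_split u H B g C"
  shows "\<exists>\<xi> \<phi>. seq_hom H (J_alg u z H C) J_incl (T_alg u z H C) (counit C) C A f B g C \<xi> \<phi> (\<lambda>c. c)"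
proof -
  have A: "is_alg z H A" and B: "is_alg z H B" and C: "is_alg z H C"
    and f: "f \<in> alg_hom H A B" and g: "g \<in> alg_hom H B C" and ker: "is_ker A f B g C"
    using ext by (auto simp: extension_def)
  note J = J_extension[OF H C, of u, unfolded extension_def]
  obtain s where s: "s \<in> under_hom u H C B" and gs: "\<And>c. c \<in> carrier C \<Longrightarrow> g (s c) = c"
    using split by (auto simp: F_split_def)
  define \<phi> where "\<phi> = free_lift B s"
  have \<phi>: "\<phi> \<in> alg_hom H (T_alg u z H C) B"
    and \<phi>e: "\<And>c. c \<in> carrier C \<Longrightarrow> \<phi> (free_unit u z H C c) = s c"
    unfolding \<phi>_def T_alg_def by (rule free_alg_universal(1,2)[OF H B s])+
  have g\<phi>: "g (\<phi> a) = counit C a" if "a \<in> carrier (T_alg u z H C)" for a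
    by (rule free_alg_hom_eqI[OF H is_alg_under[OF C] C
          alg_hom_comp[OF \<phi> g, unfolded T_alg_def] counit_hom(1)[OF H C, unfolded T_alg_def]
          _ that[unfolded T_alg_def]])
      (simp add: \<phi>e gs counit_hom(2)[OF H C])
  have "\<exists>\<xi> \<in> alg_hom H (J_alg u z H C) A. \<forall>a\<in>carrier (J_alg u z H C). f (\<xi> a) = \<phi> (J_incl a)"
  proof (rule ker_test_ex[OF is_ker_universal[OF A B _ f ker]])
    show "is_alg z H (J_alg u z H C)" using J by blast
    show "(\<lambda>a. \<phi> (J_incl a)) \<in> alg_hom H (J_alg u z H C) B"
      using J by (intro alg_hom_comp[OF _ \<phi>]) blast
    show "g (\<phi> (J_incl a)) = \<zero>\<^bsub>C\<^esub>" if "a \<in> carrier (J_alg u z H C)" for a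
      using that g\<phi> by (auto simp: J_alg_def J_incl_def a_kernel_def')
  qed
  then obtain \<xi> where "\<xi> \<in> alg_hom H (J_alg u z H C) A"
    "\<forall>a\<in>carrier (J_alg u z H C). f (\<xi> a) = \<phi> (J_incl a)" ..
  thus ?thesis
    using \<phi> g\<phi> by (intro exI[of _ \<xi>] exI[of _ \<phi>]) (simp add: seq_hom_def alg_hom_id)
qed

text \<open>
  A homotopy between \<open>\<phi>\<close> and \<open>\<phi>'\<close> that is constant over \<open>C\<close> restricts to one between \<open>\<xi>\<close> and
  \<open>\<xi>'\<close>, because \<open>J\<close> lies over \<open>0\<close>.
\<close>

lemma seq_hom_from_J_unique:
  assumes H: "ring H" and ext: "extension z H A f B g C"
    and hom: "seq_hom H (J_alg u z H C) J_incl (T_alg u z H C) (counit C) C A f B g C \<xi> \<phi> (\<lambda>c. c)"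
    and hom': "seq_hom H (J_alg u z H C) J_incl (T_alg u z H C) (counit C) C A f B g C \<xi>' \<phi>' (\<lambda>c. c)"
  shows "elem_homotopic H (J_alg u z H C) A \<xi> \<xi>'"
proof -
  let ?T = "T_alg u z H C" and ?J = "J_alg u z H C"
  have A: "is_alg z H A" and B: "is_alg z H B" and C: "is_alg z H C"
    and f: "f \<in> alg_hom H A B" and g: "g \<in> alg_hom H B C" and ker: "is_ker A f B g C"
    using ext by (auto simp: extension_def)
  note J = J_extension[OF H C, of u, unfolded extension_def]
  have xi: "\<xi> \<in> alg_hom H ?J A" "\<And>a. a \<in> carrier ?J \<Longrightarrow> \<phi> a = f (\<xi> a)"
    and \<phi>: "\<phi> \<in> alg_hom H ?T B" "\<And>a. a \<in> carrier ?T \<Longrightarrow> g (\<phi> a) = counit C a"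
    using hom by (auto simp: seq_hom_def J_incl_def)
  have xi': "\<xi>' \<in> alg_hom H ?J A" "\<And>a. a \<in> carrier ?J \<Longrightarrow> \<phi>' a = f (\<xi>' a)"
    and \<phi>': "\<phi>' \<in> alg_hom H ?T B" "\<And>a. a \<in> carrier ?T \<Longrightarrow> g (\<phi>' a) = counit C a"
    using hom' by (auto simp: seq_hom_def J_incl_def)
  have over: "g (\<phi> a) = g (\<phi>' a)" if "a \<in> carrier ?T" for a using \<phi>(2) \<phi>'(2) that by simp
  have "\<exists>\<Phi> \<in> alg_hom H ?T (poly_alg B). \<forall>a\<in>carrier ?T.
      poly_ev B 0 (\<Phi> a) = \<phi> a \<and> poly_ev B 1 (\<Phi> a) = \<phi>' a \<and>
      (\<lambda>i. g (\<Phi> a i)) = poly_line C (g (\<phi> a)) (g (\<phi> a))"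
    unfolding T_alg_def
    by (rule free_alg_homotopy[OF H is_alg_under[OF C] B C \<phi>(1)[unfolded T_alg_def]
          \<phi>'(1)[unfolded T_alg_def] g over[unfolded T_alg_def]])
  then obtain \<Phi> where \<Phi>: "\<Phi> \<in> alg_hom H ?T (poly_alg B)"
    and \<Phi>_T: "\<forall>a\<in>carrier ?T. poly_ev B 0 (\<Phi> a) = \<phi> a \<and> poly_ev B 1 (\<Phi> a) = \<phi>' a \<and>
      (\<lambda>i. g (\<Phi> a i)) = poly_line C (g (\<phi> a)) (g (\<phi> a))" ..
  have ev: "poly_ev B 0 (\<Phi> a) = \<phi> a" "poly_ev B 1 (\<Phi> a) = \<phi>' a"
    and g\<Phi>: "(\<lambda>i. g (\<Phi> a i)) = poly_line C (g (\<phi> a)) (g (\<phi> a))" if "a \<in> carrier ?T" for a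
    using \<Phi>_T that by simp_all
  have JT: "a \<in> carrier ?T" "counit C a = \<zero>\<^bsub>C\<^esub>" if "a \<in> carrier ?J" for a
    using that by (auto simp: J_alg_def a_kernel_def')
  interpret C: abelian_group C by (rule is_alg_group[OF C])
  have "\<exists>h \<in> alg_hom H ?J (poly_alg A). \<forall>a\<in>carrier ?J. (\<lambda>i. f (h a i)) = \<Phi> (J_incl a)"
  proof (rule ker_test_ex[OF is_ker_universal[OF is_alg_poly[OF A] is_alg_poly[OF B] _
          poly_map_hom[OF A B f] poly_map_ker[OF A B f ker]]])
    show "is_alg z H ?J" using J by blast
    show "(\<lambda>a. \<Phi> (J_incl a)) \<in> alg_hom H ?J (poly_alg B)"
      using J by (intro alg_hom_comp[OF _ \<Phi>]) blast
    show "(\<lambda>i. g (\<Phi> (J_incl a) i)) = \<zero>\<^bsub>poly_alg C\<^esub>" if "a \<in> carrier ?J" for a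
      using JT[OF that] g\<Phi> \<phi>(2) by (auto simp: J_incl_def poly_ops poly_line_def a_minus_def C.r_neg)
  qed
  then obtain h where h: "h \<in> alg_hom H ?J (poly_alg A)"
    and fh: "\<And>a. a \<in> carrier ?J \<Longrightarrow> (\<lambda>i. f (h a i)) = \<Phi> a"
    by (auto simp: J_incl_def)
  have inj: "inj_on f (carrier A)" using ker by (simp add: is_ker_def bij_betw_def)
  have fev: "f (poly_ev A k (h a)) = poly_ev B k (\<Phi> a)" if "a \<in> carrier ?J" for k a
    using poly_ev_map[OF A B f alg_hom_closed[OF h that], of k] fh[OF that] by simp
  have "poly_ev A 0 (h a) = \<xi> a \<and> poly_ev A 1 (h a) = \<xi>' a" if a: "a \<in> carrier ?J" for a
  proof
    note cl = alg_hom_closed[OF poly_ev_hom[OF A] alg_hom_closed[OF h a]]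
    have "f (poly_ev A 0 (h a)) = f (\<xi> a)" by (simp only: fev[OF a] ev[OF JT(1)[OF a]] xi(2)[OF a])
    thus "poly_ev A 0 (h a) = \<xi> a" by (rule inj_onD[OF inj _ cl alg_hom_closed[OF xi(1) a]])
    have "f (poly_ev A 1 (h a)) = f (\<xi>' a)" by (simp only: fev[OF a] ev[OF JT(1)[OF a]] xi'(2)[OF a])
    thus "poly_ev A 1 (h a) = \<xi>' a" by (rule inj_onD[OF inj _ cl alg_hom_closed[OF xi'(1) a]])
  qed
  thus ?thesis using h by (auto simp: elem_homotopic_def)
qed

theorem proposition4p4p1:
  fixes u :: underlying and z :: bool and H :: "'h ring"
    and A :: "('h, 'a) bimod" and B :: "('h, 'b) bimod" and C :: "('h, 'c) bimod"
    and f :: "'a \<Rightarrow> 'b" and g :: "'b \<Rightarrow> 'c"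
  assumes "ring H" and "z \<longrightarrow> cring H"
    and "extension z H A f B g C" and "F_split u H B g C"
  shows "extension z H (J_alg u z H C) J_incl (T_alg u z H C) (counit C) C \<and>
    (\<exists>\<xi> \<phi>. seq_hom H (J_alg u z H C) J_incl (T_alg u z H C) (counit C) C A f B g C \<xi> \<phi> (\<lambda>c. c)) \<and>
    (\<forall>\<xi> \<phi> \<xi>' \<phi>'.
       seq_hom H (J_alg u z H C) J_incl (T_alg u z H C) (counit C) C A f B g C \<xi> \<phi> (\<lambda>c. c) \<and>
       seq_hom H (J_alg u z H C) J_incl (T_alg u z H C) (counit C) C A f B g C \<xi>' \<phi>' (\<lambda>c. c) \<longrightarrow>
       elem_homotopic H (J_alg u z H C) A \<xi> \<xi>')"
proof (intro conjI allI impI)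
  have C: "is_alg z H C" using assms(3) by (simp add: extension_def)
  show "extension z H (J_alg u z H C) J_incl (T_alg u z H C) (counit C) C"
    by (rule J_extension[OF assms(1) C])
qed (use seq_hom_from_J_ex[OF assms(1,3,4)] seq_hom_from_J_unique[OF assms(1,3)] in auto)

end
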